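(* Let a PDE be first order in time and with mixed derivatives, of the form $\partial_tu+\sum_{j=1}^m a_{1,j}\,\partial_t\partial_x^ju+\sum_{j=0}^m a_{0,j}\,\partial_x^ju=0$ with constant coefficients, and put $p(z):=-\sum_{j=0}^m a_{0,j}z^j$ and $q(z):=1+\sum_{j=1}^m a_{1,j}z^j$. Then for all $\rho>0$ such that $\{z\in\mathbb{C}:q(z)=0\}\subset\mathbb{C}\setminus\rho\overline{\mathbb{D}}$, the associated solution semigroup $(e^{t(p/q)(\partial_x)})_{t\ge0}$ is Devaney chaotic on $X_\rho$ if and only if there are some $z_0\in\rho\mathbb{D}$ and $\lambda_0\in i\mathbb{R}$ such that $p(z_0)=\lambda_0q(z_0)$. Moreover, if $q(\partial_x):=I-\alpha\partial_x^k$ for some $\alpha\in\mathbb{C}$ and $k\in\mathbb{N}$, then, for each $0<\rho<\frac{1}{|\alpha|^{1/k}}$, the associated solution semigroup is Devaney chaotic on $X_\rho$ if and only if there are some $z_0\in\rho\mathbb{D}$, $\lambda_0\in i\mathbb{R}$ such that $p(z_0)=\lambda_0(1-\alpha z_0^k)$.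
   Context: $\mathbb{D}=\{z\in\mathbb{C}:|z|<1\}$. For $\rho>0$ the Herzog space is $X_\rho=\{f:\mathbb{R}\to\mathbb{C}: f(x)=\sum_{n\ge0}\frac{a_n\rho^n}{n!}x^n,\ (a_n)_{n\ge0}\in c_0(\mathbb{N}_0)\}$ with norm $\|f\|=\sup_n|a_n|$. The derivative $\partial_x$ is a bounded operator on $X_\rho$ with $\sigma(\partial_x)=\rho\overline{\mathbb{D}}$; holomorphic functions of $\partial_x$ are defined by the Riesz–Dunford functional calculus. When $q$ has no zeros in $\rho\overline{\mathbb{D}}$, $q(\partial_x)$ is invertible and the PDE is rewritten as $\partial_tu=(p/q)(\partial_x)u$, $u(0)=u_0\in X_\rho$. A $C_0$-semigroup $(T_t)_{t\ge0}$ is Devaney chaotic if $\{T_tx:t\ge0\}$ is dense for some $x$ and the set of periodic points ($x$ with $T_tx=x$ for some $t>0$) is dense.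
   Formalization: Both parts additionally assume that p is not identically c·q with a constant c in iR (in the second part q = 1 − αz^k); in that case the semigroup is e^{tc}I, which is not chaotic although the right-hand condition holds, so the claim fails (e.g. p = 0, q = 1). *)

theory Defs
  imports "HOL-Complex_Analysis.Complex_Analysis"
begin

section \<open>Complex Banach spaces and the Riesz--Dunford calculus\<close>

class complex_banach = banach +
  fixes scaleC :: "complex \<Rightarrow> 'a \<Rightarrow> 'a"  (infixr \<open>*\<^sub>C\<close> 75)
  assumes scaleC_add_right: "c *\<^sub>C (x + y) = c *\<^sub>C x + c *\<^sub>C y"
    and scaleC_add_left: "(c + d) *\<^sub>C x = c *\<^sub>C x + d *\<^sub>C x"
    and scaleC_scaleC: "c *\<^sub>C (d *\<^sub>C x) = (c * d) *\<^sub>C x"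
    and scaleR_eq_scaleC: "r *\<^sub>R x = complex_of_real r *\<^sub>C x"
    and norm_scaleC: "norm (c *\<^sub>C x) = cmod c * norm x"

lemma bounded_linear_scaleC: "bounded_linear (\<lambda>x::'a::complex_banach. c *\<^sub>C x)"
proof
  fix x y :: 'a and r :: real
  show "c *\<^sub>C (x + y) = c *\<^sub>C x + c *\<^sub>C y"
    by (rule scaleC_add_right)
  show "c *\<^sub>C (r *\<^sub>R x) = r *\<^sub>R (c *\<^sub>C x)"
    by (simp add: scaleR_eq_scaleC scaleC_scaleC mult.commute)
  show "\<exists>K. \<forall>x::'a. norm (c *\<^sub>C x) \<le> norm x * K"
    by (rule exI[of _ "cmod c"]) (simp add: norm_scaleC mult.commute)
qed

text \<open>
  The operator \<open>c I\<close>. The library's bounded operators form a real vector space only, so the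
  complex multiple \<open>c A\<close> of an operator \<open>A\<close> is written \<open>scalar_op c o\<^sub>L A\<close>.
\<close>

definition scalar_op :: "complex \<Rightarrow> ('a::complex_banach \<Rightarrow>\<^sub>L 'a)" where
  "scalar_op c = Blinfun (\<lambda>x. c *\<^sub>C x)"

lemma scalar_op_apply [simp]: "blinfun_apply (scalar_op c) x = c *\<^sub>C x"
  by (simp add: scalar_op_def bounded_linear_Blinfun_apply bounded_linear_scaleC)

definition is_op_inverse :: "('a::complex_banach \<Rightarrow>\<^sub>L 'a) \<Rightarrow> ('a \<Rightarrow>\<^sub>L 'a) \<Rightarrow> bool" where
  "is_op_inverse A B \<longleftrightarrow> A o\<^sub>L B = id_blinfun \<and> B o\<^sub>L A = id_blinfun"

definition op_spectrum :: "('a::complex_banach \<Rightarrow>\<^sub>L 'a) \<Rightarrow> complex set" where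
  "op_spectrum A = {z. \<nexists>B. is_op_inverse (scalar_op z - A) B}"

definition resolvent :: "('a::complex_banach \<Rightarrow>\<^sub>L 'a) \<Rightarrow> complex \<Rightarrow> ('a \<Rightarrow>\<^sub>L 'a)" where
  "resolvent A z = (THE B. is_op_inverse (scalar_op z - A) B)"

text \<open>The vector-valued analogue of \<^const>\<open>contour_integral\<close>.\<close>

definition op_contour_integral ::
    "(real \<Rightarrow> complex) \<Rightarrow> (complex \<Rightarrow> ('a::complex_banach \<Rightarrow>\<^sub>L 'a)) \<Rightarrow> ('a \<Rightarrow>\<^sub>L 'a)" where
  "op_contour_integral \<gamma> F =
     integral {0..1} (\<lambda>t. scalar_op (vector_derivative \<gamma> (at t within {0..1})) o\<^sub>L F (\<gamma> t))"

text \<open>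
  \<open>\<gamma>\<close> surrounds the spectrum of \<open>A\<close> once, inside an open neighbourhood of the spectrum
  on which \<open>f\<close> is holomorphic. We only integrate over a single closed path (not over a cycle of
  several paths); this suffices for operators whose spectrum is a disc.
\<close>

definition dunford_contour ::
    "(complex \<Rightarrow> complex) \<Rightarrow> ('a::complex_banach \<Rightarrow>\<^sub>L 'a) \<Rightarrow> (real \<Rightarrow> complex) \<Rightarrow> bool" where
  "dunford_contour f A \<gamma> \<longleftrightarrow>
     (\<exists>U. open U \<and> op_spectrum A \<subseteq> U \<and> f holomorphic_on U \<and>
          valid_path \<gamma> \<and> pathfinish \<gamma> = pathstart \<gamma> \<and> path_image \<gamma> \<subseteq> U - op_spectrum A \<and>
          (\<forall>z\<in>op_spectrum A. winding_number \<gamma> z = 1) \<and>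
          (\<forall>z. z \<notin> U \<longrightarrow> winding_number \<gamma> z = 0))"

text \<open>
  \<open>f(A) = (2\<pi>i)\<^sup>-\<^sup>1 \<integral>\<^sub>\<gamma> f(z) (z I - A)\<^sup>-\<^sup>1 dz\<close>, which does not depend on the
  choice of \<open>\<gamma>\<close>.
\<close>

definition riesz_dunford ::
    "(complex \<Rightarrow> complex) \<Rightarrow> ('a::complex_banach \<Rightarrow>\<^sub>L 'a) \<Rightarrow> ('a \<Rightarrow>\<^sub>L 'a)" where
  "riesz_dunford f A =
     scalar_op (1 / (2 * of_real pi * \<i>)) o\<^sub>L
       op_contour_integral (SOME \<gamma>. dunford_contour f A \<gamma>)
         (\<lambda>z. scalar_op (f z) o\<^sub>L resolvent A z)"

definition op_exp :: "('a::banach \<Rightarrow>\<^sub>L 'a) \<Rightarrow> ('a \<Rightarrow>\<^sub>L 'a)" where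
  "op_exp A = (\<Sum>n. (1 / fact n) *\<^sub>R (((o\<^sub>L) A ^^ n) id_blinfun))"


section \<open>The sequence space \<open>c\<^sub>0\<close>\<close>

typedef c0 = "{a :: nat \<Rightarrow> complex. a \<longlonglongrightarrow> 0}"
  by (rule exI[of _ "\<lambda>_. 0"]) simp

lemma Rep_c0_tendsto: "Rep_c0 a \<longlonglongrightarrow> 0"
  using Rep_c0[of a] by simp

lemma Rep_c0_inverse': "a \<longlonglongrightarrow> 0 \<Longrightarrow> Rep_c0 (Abs_c0 a) = a"
  by (simp add: Abs_c0_inverse)

instantiation c0 :: real_normed_vector
begin

definition "0 = Abs_c0 (\<lambda>_. 0)"
definition "a + b = Abs_c0 (\<lambda>n. Rep_c0 a n + Rep_c0 b n)"
definition "a - b = Abs_c0 (\<lambda>n. Rep_c0 a n - Rep_c0 b n)"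
definition "- a = Abs_c0 (\<lambda>n. - Rep_c0 a n)"
definition "r *\<^sub>R a = Abs_c0 (\<lambda>n. complex_of_real r * Rep_c0 a n)"
definition "norm a = (SUP n. cmod (Rep_c0 a n))"
definition "dist a b = norm (a - b)" for a b :: c0
definition "sgn a = inverse (norm a) *\<^sub>R a" for a :: c0
definition uniformity_c0 :: "(c0 \<times> c0) filter"
  where "uniformity_c0 = (INF e\<in>{0 <..}. principal {(x, y). dist x y < e})"
definition open_c0 :: "c0 set \<Rightarrow> bool"
  where "open_c0 S = (\<forall>x\<in>S. \<forall>\<^sub>F (x', y) in uniformity. x' = x \<longrightarrow> y \<in> S)"

lemma Rep_c0_simps [simp]:
  "Rep_c0 0 n = 0"
  "Rep_c0 (a + b) n = Rep_c0 a n + Rep_c0 b n"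
  "Rep_c0 (a - b) n = Rep_c0 a n - Rep_c0 b n"
  "Rep_c0 (- a) n = - Rep_c0 a n"
  "Rep_c0 (r *\<^sub>R a) n = complex_of_real r * Rep_c0 a n"
  unfolding zero_c0_def plus_c0_def minus_c0_def uminus_c0_def scaleR_c0_def
  using Rep_c0_tendsto[of a] Rep_c0_tendsto[of b]
  by (subst Rep_c0_inverse'; auto intro!: tendsto_eq_intros)+

lemma c0_eqI: "(\<And>n. Rep_c0 a n = Rep_c0 b n) \<Longrightarrow> a = b"
  by (metis Rep_c0_inject ext)

lemma bdd_above_c0: "bdd_above (range (\<lambda>n. cmod (Rep_c0 a n)))"
proof -
  have "Bseq (Rep_c0 a)"
    using Rep_c0_tendsto[of a] convergentI convergent_imp_Bseq by blast
  then show ?thesis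
    by (auto simp: Bseq_def bdd_above_def)
qed

lemma norm_Rep_c0_le: "cmod (Rep_c0 a n) \<le> norm a"
  unfolding norm_c0_def by (rule cSUP_upper[OF _ bdd_above_c0]) simp

lemma norm_c0_leI: "(\<And>n. cmod (Rep_c0 a n) \<le> B) \<Longrightarrow> norm a \<le> B"
  unfolding norm_c0_def by (rule cSUP_least) auto

instance
proof
  fix a b c :: c0 and r s :: real
  show "a + b + c = a + (b + c)" "a + b = b + a" "0 + a = a" "- a + a = 0" "a - b = a + - b"
    "r *\<^sub>R (a + b) = r *\<^sub>R a + r *\<^sub>R b" "(r + s) *\<^sub>R a = r *\<^sub>R a + s *\<^sub>R a"
    "r *\<^sub>R s *\<^sub>R a = (r * s) *\<^sub>R a" "1 *\<^sub>R a = a"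
    by (rule c0_eqI; simp add: algebra_simps)+
  show "dist a b = norm (a - b)" by (rule dist_c0_def)
  show "sgn a = inverse (norm a) *\<^sub>R a" by (rule sgn_c0_def)
  show "uniformity = (INF e\<in>{0 <..}. principal {(x::c0, y). dist x y < e})"
    by (rule uniformity_c0_def)
  show "open S = (\<forall>x\<in>S. \<forall>\<^sub>F (x', y) in uniformity. x' = x \<longrightarrow> y \<in> S)" for S :: "c0 set"
    by (rule open_c0_def)
  show "norm a = 0 \<longleftrightarrow> a = 0"
  proof
    assume "norm a = 0"
    then have "Rep_c0 a n = 0" for n using norm_Rep_c0_le[of a n] by simp
    then show "a = 0" by (intro c0_eqI) simp
  qed (simp add: norm_c0_def)
  show "norm (a + b) \<le> norm a + norm b"
    by (rule norm_c0_leI)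
      (auto intro!: order_trans[OF norm_triangle_ineq] add_mono norm_Rep_c0_le)
  have le: "norm (r *\<^sub>R a) \<le> \<bar>r\<bar> * norm a" for r and a :: c0
    by (rule norm_c0_leI) (simp add: norm_mult mult_left_mono norm_Rep_c0_le)
  show "norm (r *\<^sub>R a) = \<bar>r\<bar> * norm a"
  proof (cases "r = 0")
    case True
    have "norm (r *\<^sub>R a) = 0" unfolding norm_c0_def by (simp add: True)
    then show ?thesis using True by simp
  next
    case False
    have "a = inverse r *\<^sub>R (r *\<^sub>R a)"
      using False by (intro c0_eqI) simp
    then have "norm a \<le> \<bar>inverse r\<bar> * norm (r *\<^sub>R a)"
      using le[of "inverse r" "r *\<^sub>R a"] by simp
    then show ?thesis using le[of r a] False by (simp add: field_simps)
  qed
qed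

end

instance c0 :: banach
proof
  fix X :: "nat \<Rightarrow> c0"
  assume "Cauchy X"
  then have C: "\<exists>M. \<forall>m\<ge>M. \<forall>k\<ge>M. norm (X m - X k) < e" if "e > 0" for e
    using that by (simp add: Cauchy_def dist_c0_def)
  have coord: "cmod (Rep_c0 (X m) n - Rep_c0 (X k) n) \<le> norm (X m - X k)" for m k n
    using norm_Rep_c0_le[of "X m - X k" n] by simp
  have "Cauchy (\<lambda>m. Rep_c0 (X m) n)" for n
  proof (rule CauchyI)
    fix e :: real assume "e > 0"
    then obtain M where "\<forall>m\<ge>M. \<forall>k\<ge>M. norm (X m - X k) < e" using C by blast
    then show "\<exists>M. \<forall>m\<ge>M. \<forall>k\<ge>M. cmod (Rep_c0 (X m) n - Rep_c0 (X k) n) < e"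
      using order_le_less_trans[OF coord] by (intro exI[of _ M]) simp
  qed
  then have l: "(\<lambda>m. Rep_c0 (X m) n) \<longlonglongrightarrow> lim (\<lambda>m. Rep_c0 (X m) n)" for n
    by (simp add: Cauchy_convergent convergent_LIMSEQ_iff[symmetric])
  define l where "l n = lim (\<lambda>m. Rep_c0 (X m) n)" for n
  note l = l[folded l_def]
  have unif: "\<exists>M. \<forall>m\<ge>M. \<forall>n. cmod (Rep_c0 (X m) n - l n) \<le> e" if e: "e > 0" for e
  proof -
    obtain M where M: "\<forall>m\<ge>M. \<forall>k\<ge>M. norm (X m - X k) < e" using C[OF e] by blast
    have "cmod (Rep_c0 (X m) n - l n) \<le> e" if "m \<ge> M" for m n
    proof (rule tendsto_upperbound)
      show "(\<lambda>k. cmod (Rep_c0 (X m) n - Rep_c0 (X k) n)) \<longlonglongrightarrow> cmod (Rep_c0 (X m) n - l n)"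
        by (intro tendsto_intros l)
      show "\<forall>\<^sub>F k in sequentially. cmod (Rep_c0 (X m) n - Rep_c0 (X k) n) \<le> e"
        unfolding eventually_sequentially
      proof (intro exI[of _ M] allI impI)
        fix k assume "k \<ge> M"
        then have "norm (X m - X k) < e" using M that by simp
        with coord[of m n k] show "cmod (Rep_c0 (X m) n - Rep_c0 (X k) n) \<le> e" by linarith
      qed
    qed simp
    then show ?thesis by blast
  qed
  have "l \<longlonglongrightarrow> 0"
  proof (rule LIMSEQ_I)
    fix e :: real assume e: "e > 0"
    obtain M where M: "cmod (Rep_c0 (X M) n - l n) \<le> e / 2" for n
      using unif[of "e / 2"] e by auto
    obtain N where N: "cmod (Rep_c0 (X M) n) < e / 2" if "n \<ge> N" for n
      using LIMSEQ_D[OF Rep_c0_tendsto[of "X M"], of "e / 2"] e by auto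
    have "cmod (l n - 0) < e" if "n \<ge> N" for n
      using M[of n] N[OF that] norm_triangle_ineq4[of "Rep_c0 (X M) n" "Rep_c0 (X M) n - l n"]
      unfolding diff_diff_eq2 by simp
    then show "\<exists>N. \<forall>n\<ge>N. cmod (l n - 0) < e" by blast
  qed
  then have R: "Rep_c0 (Abs_c0 l) = l" by (rule Rep_c0_inverse')
  have "X \<longlonglongrightarrow> Abs_c0 l"
  proof (rule LIMSEQ_I)
    fix e :: real assume e: "e > 0"
    then obtain M where M: "\<forall>m\<ge>M. \<forall>n. cmod (Rep_c0 (X m) n - l n) \<le> e / 2"
      using unif[of "e / 2"] by auto
    have "norm (X m - Abs_c0 l) \<le> e / 2" if "m \<ge> M" for m
      using M that by (intro norm_c0_leI) (simp add: R)
    then show "\<exists>M. \<forall>m\<ge>M. norm (X m - Abs_c0 l) < e"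
    proof (intro exI[of _ M] allI impI)
      fix m assume "m \<ge> M"
      then have "norm (X m - Abs_c0 l) \<le> e / 2" by fact
      with e show "norm (X m - Abs_c0 l) < e" by linarith
    qed
  qed
  then show "convergent X" by (rule convergentI)
qed

instantiation c0 :: complex_banach
begin

definition "c *\<^sub>C a = Abs_c0 (\<lambda>n. c * Rep_c0 a n)"

lemma Rep_c0_scaleC [simp]: "Rep_c0 (c *\<^sub>C a) n = c * Rep_c0 a n"
  unfolding scaleC_c0_def using Rep_c0_tendsto[of a]
  by (subst Rep_c0_inverse') (auto intro!: tendsto_eq_intros)

instance
proof
  fix a b :: c0 and r :: real and c d :: complex
  show "c *\<^sub>C (a + b) = c *\<^sub>C a + c *\<^sub>C b" "(c + d) *\<^sub>C a = c *\<^sub>C a + d *\<^sub>C a"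
    "c *\<^sub>C d *\<^sub>C a = (c * d) *\<^sub>C a" "r *\<^sub>R a = complex_of_real r *\<^sub>C a"
    by (rule c0_eqI; simp add: algebra_simps)+
  have le: "norm (c *\<^sub>C a) \<le> cmod c * norm a" for c and a :: c0
    by (rule norm_c0_leI) (simp add: norm_mult mult_left_mono norm_Rep_c0_le)
  show "norm (c *\<^sub>C a) = cmod c * norm a"
  proof (cases "c = 0")
    case True
    then show ?thesis using le[of c a] by simp
  next
    case False
    have "a = inverse c *\<^sub>C (c *\<^sub>C a)"
      using False by (intro c0_eqI) simp
    then have "norm a \<le> cmod (inverse c) * norm (c *\<^sub>C a)"
      using le[of "inverse c" "c *\<^sub>C a"] by simp
    then show ?thesis using le[of c a] False by (simp add: norm_divide field_simps)
  qed
qed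

end


section \<open>Herzog spaces\<close>

definition herzog_fun :: "real \<Rightarrow> c0 \<Rightarrow> real \<Rightarrow> complex" where
  "herzog_fun \<rho> a x = (\<Sum>n. Rep_c0 a n * of_real \<rho> ^ n / fact n * of_real x ^ n)"

definition herzog_space :: "real \<Rightarrow> (real \<Rightarrow> complex) set" where
  "herzog_space \<rho> = range (herzog_fun \<rho>)"

lemma herzog_space_eq:
  "herzog_space \<rho> =
     {f. \<exists>a::nat \<Rightarrow> complex. a \<longlonglongrightarrow> 0 \<and>
           f = (\<lambda>x. \<Sum>n. a n * of_real \<rho> ^ n / fact n * of_real x ^ n)}"
proof (rule set_eqI, rule iffI)
  fix f assume "f \<in> herzog_space \<rho>"
  then obtain a where "f = herzog_fun \<rho> a" by (auto simp: herzog_space_def)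
  then show "f \<in> {f. \<exists>a::nat \<Rightarrow> complex. a \<longlonglongrightarrow> 0 \<and>
           f = (\<lambda>x. \<Sum>n. a n * of_real \<rho> ^ n / fact n * of_real x ^ n)}"
    using Rep_c0_tendsto[of a] by (auto simp: herzog_fun_def[abs_def])
next
  fix f assume "f \<in> {f. \<exists>a::nat \<Rightarrow> complex. a \<longlonglongrightarrow> 0 \<and>
           f = (\<lambda>x. \<Sum>n. a n * of_real \<rho> ^ n / fact n * of_real x ^ n)}"
  then obtain a where "a \<longlonglongrightarrow> 0" "f = (\<lambda>x. \<Sum>n. a n * of_real \<rho> ^ n / fact n * of_real x ^ n)"
    by blast
  then have "f = herzog_fun \<rho> (Abs_c0 a)"
    by (simp add: herzog_fun_def[abs_def] Rep_c0_inverse')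
  then show "f \<in> herzog_space \<rho>" by (simp add: herzog_space_def)
qed

text \<open>The sequence \<open>(a\<^sub>n)\<close> belonging to \<open>f \<in> X\<^sub>\<rho>\<close>; see \<open>inj_herzog_fun\<close> below.\<close>

definition herzog_coeff :: "real \<Rightarrow> (real \<Rightarrow> complex) \<Rightarrow> c0" where
  "herzog_coeff \<rho> = inv (herzog_fun \<rho>)"

definition herzog_norm :: "real \<Rightarrow> (real \<Rightarrow> complex) \<Rightarrow> real" where
  "herzog_norm \<rho> f = (SUP n. cmod (Rep_c0 (herzog_coeff \<rho> f) n))"

definition herzog_topology :: "real \<Rightarrow> (real \<Rightarrow> complex) topology" where
  "herzog_topology \<rho> =
     Metric_space.mtopology (herzog_space \<rho>) (\<lambda>f g. herzog_norm \<rho> (\<lambda>x. f x - g x))"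

text \<open>
  Operators on \<open>X\<^sub>\<rho>\<close> are transported to the Banach space type \<^typ>\<open>c0\<close> along the isometry
  \<open>herzog_fun \<rho>\<close>, because the norm of \<open>X\<^sub>\<rho>\<close> depends on \<open>\<rho>\<close> and
  hence cannot be the norm of a type.
\<close>

definition herzog_deriv :: "real \<Rightarrow> c0 \<Rightarrow>\<^sub>L c0" where
  "herzog_deriv \<rho> =
     Blinfun (\<lambda>a. herzog_coeff \<rho> (\<lambda>x. vector_derivative (herzog_fun \<rho> a) (at x)))"

definition herzog_semigroup ::
    "real \<Rightarrow> (complex \<Rightarrow> complex) \<Rightarrow> real \<Rightarrow> (real \<Rightarrow> complex) \<Rightarrow> (real \<Rightarrow> complex)" where
  "herzog_semigroup \<rho> f t u =
     herzog_fun \<rho>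
       (blinfun_apply (op_exp (t *\<^sub>R riesz_dunford f (herzog_deriv \<rho>))) (herzog_coeff \<rho> u))"

lemma herzog_fun_summable:
  "summable (\<lambda>n. Rep_c0 a n * of_real \<rho> ^ n / fact n * z ^ n)" for z :: complex
proof (rule summable_comparison_test')
  show "summable (\<lambda>n. norm a * (inverse (fact n) * (\<bar>\<rho>\<bar> * cmod z) ^ n))"
    by (intro summable_mult summable_exp)
  show "norm (Rep_c0 a n * of_real \<rho> ^ n / fact n * z ^ n)
        \<le> norm a * (inverse (fact n) * (\<bar>\<rho>\<bar> * cmod z) ^ n)" for n
    using mult_right_mono[OF norm_Rep_c0_le[of a n], of "inverse (fact n) * (\<bar>\<rho>\<bar> * cmod z) ^ n"]
    by (simp add: norm_mult norm_divide norm_power power_mult_distrib field_simps)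
qed

lemma herzog_fun_has_vector_derivative:
  "(herzog_fun \<rho> a has_vector_derivative
      (\<Sum>n. diffs (\<lambda>n. Rep_c0 a n * of_real \<rho> ^ n / fact n) n * of_real x ^ n)) (at x)"
proof -
  have "((\<lambda>z. \<Sum>n. Rep_c0 a n * of_real \<rho> ^ n / fact n * z ^ n) has_field_derivative
      (\<Sum>n. diffs (\<lambda>n. Rep_c0 a n * of_real \<rho> ^ n / fact n) n * of_real x ^ n))
      (at (complex_of_real x))"
    by (rule termdiffs_strong_converges_everywhere) (rule herzog_fun_summable)
  from has_vector_derivative_real_field[OF this]
  show ?thesis by (simp add: herzog_fun_def[abs_def])
qed

lemma herzog_fun_diff: "herzog_fun \<rho> (a - b) x = herzog_fun \<rho> a x - herzog_fun \<rho> b x"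
  unfolding herzog_fun_def
  by (subst suminf_diff[OF herzog_fun_summable herzog_fun_summable])
    (simp add: algebra_simps diff_divide_distrib)

lemma inj_herzog_fun:
  assumes "\<rho> > 0"
  shows "inj (herzog_fun \<rho>)"
proof (rule injI)
  fix a b assume eq: "herzog_fun \<rho> a = herzog_fun \<rho> b"
  define c where "c n = Rep_c0 (a - b) n * of_real \<rho> ^ n / fact n" for n
  define F where "F z = (\<Sum>n. c n * z ^ n)" for z :: complex
  have sums: "(\<lambda>n. c n * z ^ n) sums F z" for z
    unfolding F_def c_def by (rule summable_sums[OF herzog_fun_summable])
  have F0: "F (of_real x) = 0" for x :: real
    using herzog_fun_diff[of \<rho> a b x] eq by (simp add: F_def c_def herzog_fun_def)
  have "c n = 0" for n
  proof (rule ccontr)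
    assume n: "c n \<noteq> 0"
    have "n > 0"
      using n sums_unique2[OF sums[of 0] powser_sums_zero] F0[of 0] by (cases n) auto
    obtain s where s: "0 < s" "\<And>z. z \<in> cball 0 s - {0} \<Longrightarrow> F z \<noteq> 0"
      using powser_0_nonzero[of 1 0 c F n] sums F0[of 0] n \<open>n > 0\<close> by auto
    then show False
      using F0[of s] by (auto simp: dist_norm)
  qed
  then show "a = b"
    using assms by (intro c0_eqI) (simp add: c_def)
qed

lemma herzog_coeff_fun:
  "\<rho> > 0 \<Longrightarrow> herzog_coeff \<rho> (herzog_fun \<rho> a) = a"
  by (simp add: herzog_coeff_def inj_herzog_fun)

lemma herzog_norm_fun:
  "\<rho> > 0 \<Longrightarrow> herzog_norm \<rho> (herzog_fun \<rho> a) = norm a"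
  by (simp add: herzog_norm_def herzog_coeff_fun norm_c0_def)

lemma Metric_space_herzog:
  assumes "\<rho> > 0"
  shows "Metric_space (herzog_space \<rho>) (\<lambda>f g. herzog_norm \<rho> (\<lambda>x. f x - g x))"
proof -
  have fun_diff: "(\<lambda>x. herzog_fun \<rho> a x - herzog_fun \<rho> b x) = herzog_fun \<rho> (a - b)" for a b
    by (simp add: fun_eq_iff herzog_fun_diff)
  show ?thesis
  proof
    fix f g h :: "real \<Rightarrow> complex"
    have norm_eq: "herzog_norm \<rho> f = norm (herzog_coeff \<rho> f)" for f
      by (simp add: herzog_norm_def norm_c0_def)
    show "0 \<le> herzog_norm \<rho> (\<lambda>x. f x - g x)" by (simp add: norm_eq)
    have uminus: "(\<lambda>x. - herzog_fun \<rho> a x) = herzog_fun \<rho> (- a)" for a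
    proof
      fix x
      show "- herzog_fun \<rho> a x = herzog_fun \<rho> (- a) x"
        using herzog_fun_diff[of \<rho> 0 a x] by (simp add: herzog_fun_def[of _ 0])
    qed
    define h' where "h' = (\<lambda>x. f x - g x)"
    have neg: "(\<lambda>x. g x - f x) = (\<lambda>x. - h' x)" by (simp add: h'_def)
    have "herzog_norm \<rho> h' = herzog_norm \<rho> (\<lambda>x. - h' x)"
    proof (cases "h' \<in> herzog_space \<rho>")
      case True
      then obtain a where "h' = herzog_fun \<rho> a" by (auto simp: herzog_space_def)
      then show ?thesis using assms by (simp add: uminus herzog_norm_fun)
    next
      case False
      have junk: "herzog_coeff \<rho> u = (SOME a. False)" if "u \<notin> herzog_space \<rho>" for u
      proof -
        have "(herzog_fun \<rho> a = u) = False" for a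
          using that rangeI[of "herzog_fun \<rho>" a] unfolding herzog_space_def by blast
        then show ?thesis by (simp add: herzog_coeff_def inv_into_def)
      qed
      have "(\<lambda>x. - h' x) \<notin> herzog_space \<rho>"
      proof
        assume "(\<lambda>x. - h' x) \<in> herzog_space \<rho>"
        then obtain a where a: "(\<lambda>x. - h' x) = herzog_fun \<rho> a" by (auto simp: herzog_space_def)
        have "h' = (\<lambda>x. - herzog_fun \<rho> a x)" unfolding a[symmetric] by simp
        then show False using False by (simp add: uminus herzog_space_def)
      qed
      with False show ?thesis by (simp add: norm_eq junk)
    qed
    then show "herzog_norm \<rho> (\<lambda>x. f x - g x) = herzog_norm \<rho> (\<lambda>x. g x - f x)"
      unfolding neg unfolding h'_def .
    assume "f \<in> herzog_space \<rho>" "g \<in> herzog_space \<rho>"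
    then obtain a b where ab: "f = herzog_fun \<rho> a" "g = herzog_fun \<rho> b"
      by (auto simp: herzog_space_def)
    show "herzog_norm \<rho> (\<lambda>x. f x - g x) = 0 \<longleftrightarrow> f = g"
      using inj_herzog_fun[OF assms] assms
      by (auto simp: ab fun_diff herzog_norm_fun inj_eq)
    assume "h \<in> herzog_space \<rho>"
    then obtain c where c: "h = herzog_fun \<rho> c" by (auto simp: herzog_space_def)
    show "herzog_norm \<rho> (\<lambda>x. f x - h x)
        \<le> herzog_norm \<rho> (\<lambda>x. f x - g x) + herzog_norm \<rho> (\<lambda>x. g x - h x)"
      using norm_triangle_ineq[of "a - b" "b - c"] assms
      by (simp add: ab c fun_diff herzog_norm_fun)
  qed
qed

lemma herzog_deriv_apply:
  assumes "\<rho> > 0"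
  shows "herzog_fun \<rho> (herzog_deriv \<rho> a) x = vector_derivative (herzog_fun \<rho> a) (at x)"
    and "Rep_c0 (herzog_deriv \<rho> a) n = of_real \<rho> * Rep_c0 a (Suc n)"
proof -
  define S where "S a = Abs_c0 (\<lambda>n. of_real \<rho> * Rep_c0 a (Suc n))" for a
  have S: "Rep_c0 (S a) n = of_real \<rho> * Rep_c0 a (Suc n)" for a n
    unfolding S_def using LIMSEQ_Suc[OF Rep_c0_tendsto[of a]]
    by (subst Rep_c0_inverse') (auto intro!: tendsto_eq_intros)
  have d: "(\<lambda>x. vector_derivative (herzog_fun \<rho> a) (at x)) = herzog_fun \<rho> (S a)" for a
  proof
    fix x
    have "diffs (\<lambda>n. Rep_c0 a n * of_real \<rho> ^ n / fact n) n * of_real x ^ n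
        = Rep_c0 (S a) n * of_real \<rho> ^ n / fact n * of_real x ^ n" for n
      by (simp add: diffs_def S field_simps del: of_nat_Suc)
    then show "vector_derivative (herzog_fun \<rho> a) (at x) = herzog_fun \<rho> (S a) x"
      using vector_derivative_at[OF herzog_fun_has_vector_derivative[of \<rho> a x]]
      by (simp add: herzog_fun_def)
  qed
  have "bounded_linear S"
  proof (rule bounded_linear_intro)
    show "S (a + b) = S a + S b" "S (r *\<^sub>R a) = r *\<^sub>R S a" for a b r
      by (rule c0_eqI; simp add: S algebra_simps)+
    show "norm (S a) \<le> norm a * \<rho>" for a
      using assms norm_Rep_c0_le[of a]
      by (intro norm_c0_leI) (simp add: S norm_mult mult.commute)
  qed
  then have "herzog_deriv \<rho> a = S a"
    unfolding herzog_deriv_def d herzog_coeff_fun[OF assms]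
    by (simp add: bounded_linear_Blinfun_apply)
  then show "herzog_fun \<rho> (herzog_deriv \<rho> a) x = vector_derivative (herzog_fun \<rho> a) (at x)"
    and "Rep_c0 (herzog_deriv \<rho> a) n = of_real \<rho> * Rep_c0 a (Suc n)"
    by (simp_all add: S fun_cong[OF d, of a x])
qed


section \<open>Devaney chaos\<close>

definition devaney_chaotic :: "'a topology \<Rightarrow> (real \<Rightarrow> 'a \<Rightarrow> 'a) \<Rightarrow> bool" where
  "devaney_chaotic X T \<longleftrightarrow>
     (\<exists>x\<in>topspace X. X closure_of {T t x |t. t \<ge> 0} = topspace X) \<and>
     X closure_of {x \<in> topspace X. \<exists>t>0. T t x = x} = topspace X"


section \<open>The symbols of the equation\<close>

text \<open>
  The equation \<open>\<partial>\<^sub>t u + \<Sum>\<^sub>j a1 j \<partial>\<^sub>t \<partial>\<^sub>x\<^sup>j u + \<Sum>\<^sub>j a0 j \<partial>\<^sub>x\<^sup>j u = 0\<close> reads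
  \<open>q(\<partial>\<^sub>x) \<partial>\<^sub>t u = p(\<partial>\<^sub>x) u\<close>. If \<open>q\<close> has no zero in the closed disc of radius \<open>\<rho>\<close>,
  its solution semigroup on \<open>X\<^sub>\<rho>\<close> is \<open>herzog_semigroup \<rho> (p / q)\<close>.
\<close>

definition pde_p :: "nat \<Rightarrow> (nat \<Rightarrow> complex) \<Rightarrow> complex \<Rightarrow> complex" where
  "pde_p m a0 z = - (\<Sum>j=0..m. a0 j * z ^ j)"

definition pde_q :: "nat \<Rightarrow> (nat \<Rightarrow> complex) \<Rightarrow> complex \<Rightarrow> complex" where
  "pde_q m a1 z = 1 + (\<Sum>j=1..m. a1 j * z ^ j)"

end

theory Submission
  imports Defs
begin

text \<open>
  Through its coefficient sequence \<open>X\<^sub>\<rho>\<close> is \<open>c\<^sub>0\<close>, and there \<open>A = \<partial>\<^sub>x\<close> is \<open>\<rho>\<close> times the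
  backward shift. For every \<open>w\<close> in the open unit disc the geometric sequence \<open>e\<^sub>w = (w\<^sup>n)\<close> is an
  eigenvector of \<open>A\<close> with eigenvalue \<open>\<rho> w\<close>, hence an eigenvector of \<open>f(A)\<close> and of \<open>exp (t f(A))\<close>
  with eigenvalues \<open>f (\<rho> w)\<close> and \<open>exp (t f (\<rho> w))\<close>. The \<open>e\<^sub>w\<close> span a dense subspace, even if
  \<open>w\<close> only runs through a set with a limit point in the disc (\<open>geo_total\<close>). So an operator that
  acts on each complex line \<open>\<complex> e\<^sub>w\<close> as \<open>h (\<rho> w)\<close> is determined by its symbol \<open>h\<close>
  (\<open>has_symbol_unique\<close>), symbols multiply when operators are composed, and every function
  holomorphic near the closed disc is a symbol, namely that of its Riesz--Dunford integral
  (\<open>has_symbol_riesz_dunford\<close>). All operator identities below are read off from symbols.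

  Suppose that \<open>f = p / q\<close> takes a purely imaginary value \<open>f z\<^sub>0\<close> with \<open>\<bar>z\<^sub>0\<bar> < \<rho>\<close>. Since
  \<open>f\<close> is not that constant, it is open, so near \<open>z\<^sub>0\<close> there are points where \<open>Re f < 0\<close>, points where
  \<open>Re f > 0\<close>, and points where \<open>f\<close> is a rational multiple of \<open>2 \<pi> \<i>\<close>. The eigenvectors for the
  three kinds of points span, respectively, a dense space of orbits that tend to 0 forwards, a dense
  space of orbits that tend to 0 backwards, and a dense space of periodic points. The first two
  make the semigroup topologically transitive, and Baire's theorem then gives a dense orbit.

  Conversely, density of the periodic points provides some \<open>x \<noteq> 0\<close> and \<open>t > 0\<close> with
  \<open>exp (t f(A)) x = x\<close>. If \<open>f\<close> had no imaginary value in the open disc, the symbol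
  \<open>h = exp (t f) - 1\<close> of \<open>exp (t f(A)) - I\<close> would have no zero there. Its finitely many zeros in
  the closed disc would then lie on the circle, and dividing them out would write
  \<open>exp (t f(A)) - I\<close> as a product of factors \<open>A - \<xi>\<close> with \<open>\<bar>\<xi>\<bar> = \<rho>\<close> and of an invertible
  operator. No such \<open>\<xi>\<close> is an eigenvalue, because the sequences \<open>(\<xi> / \<rho>)\<^sup>n\<close> do not tend to 0;
  so \<open>exp (t f(A)) - I\<close> would be injective (\<open>has_symbol_injective\<close>), a contradiction.
\<close>

section \<open>Complex subspaces\<close>

definition complex_subspace :: "'a::complex_banach set \<Rightarrow> bool" where
  "complex_subspace Y \<longleftrightarrow>
     0 \<in> Y \<and> (\<forall>x\<in>Y. \<forall>y\<in>Y. x + y \<in> Y) \<and> (\<forall>c. \<forall>x\<in>Y. c *\<^sub>C x \<in> Y)"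

lemma scaleC_zero_right [simp]: "c *\<^sub>C (0::'a::complex_banach) = 0"
  using scaleC_add_right[of c "0::'a" 0] by simp

lemma scaleC_zero_left [simp]: "0 *\<^sub>C (x::'a::complex_banach) = 0"
  using scaleC_add_left[of 0 0 x] by simp

lemma scaleC_one [simp]: "1 *\<^sub>C (x::'a::complex_banach) = x"
  using scaleR_eq_scaleC[of 1 x] by simp

lemma scaleC_minus_one: "(-1) *\<^sub>C (x::'a::complex_banach) = - x"
  using scaleR_eq_scaleC[of "-1" x] by simp

lemma scaleC_diff_right: "c *\<^sub>C (x - y) = c *\<^sub>C x - c *\<^sub>C (y::'a::complex_banach)"
  by (metis (no_types, lifting) add_diff_cancel_right' diff_add_cancel scaleC_add_right)

lemma scaleC_diff_left: "(c - d) *\<^sub>C x = c *\<^sub>C x - d *\<^sub>C (x::'a::complex_banach)"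
  by (metis (no_types, lifting) add_diff_cancel_right' diff_add_cancel scaleC_add_left)

lemma bounded_linear_scaleC_left: "bounded_linear (\<lambda>c. c *\<^sub>C (x::'a::complex_banach))"
proof (rule bounded_linear_intro)
  show "(r *\<^sub>R c) *\<^sub>C x = r *\<^sub>R (c *\<^sub>C x)" for r c
    by (simp add: scaleR_eq_scaleC scaleC_scaleC scaleR_conv_of_real)
  show "norm (c *\<^sub>C x) \<le> norm c * norm x" for c
    by (simp add: norm_scaleC)
qed (rule scaleC_add_left)

lemma complex_subspaceD:
  assumes "complex_subspace Y"
  shows complex_subspace_0: "0 \<in> Y"
    and complex_subspace_add: "x \<in> Y \<Longrightarrow> y \<in> Y \<Longrightarrow> x + y \<in> Y"
    and complex_subspace_scale: "x \<in> Y \<Longrightarrow> c *\<^sub>C x \<in> Y"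
  using assms by (auto simp: complex_subspace_def)

lemma complex_subspace_diff:
  assumes "complex_subspace Y" "x \<in> Y" "y \<in> Y"
  shows "x - y \<in> Y"
  using complex_subspace_add[OF assms(1,2) complex_subspace_scale[OF assms(1,3), of "-1"]]
  by (simp add: scaleC_minus_one)

lemma complex_subspace_sum:
  assumes "complex_subspace Y" "\<And>i. i \<in> I \<Longrightarrow> g i \<in> Y"
  shows "sum g I \<in> Y"
  using assms(2)
  by (induction I rule: infinite_finite_induct)
    (auto intro: complex_subspaceD[OF assms(1)])

lemma complex_subspace_closure:
  assumes "complex_subspace Y"
  shows "complex_subspace (closure Y)"
  unfolding complex_subspace_def
proof (intro conjI ballI allI)
  show "0 \<in> closure Y"
    using complex_subspace_0[OF assms] closure_subset by blast
next
  fix x y assume "x \<in> closure Y" "y \<in> closure Y"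
  then obtain f g where "\<forall>n. f n \<in> Y" "f \<longlonglongrightarrow> x" "\<forall>n. g n \<in> Y" "g \<longlonglongrightarrow> y"
    by (auto simp: closure_sequential)
  then show "x + y \<in> closure Y"
    using tendsto_add[of f x sequentially g y] complex_subspace_add[OF assms]
    unfolding closure_sequential by (intro exI[of _ "\<lambda>n. f n + g n"]) auto
next
  fix c x assume "x \<in> closure Y"
  then obtain f where "\<forall>n. f n \<in> Y" "f \<longlonglongrightarrow> x"
    by (auto simp: closure_sequential)
  then show "c *\<^sub>C x \<in> closure Y"
    using bounded_linear.tendsto[OF bounded_linear_scaleC, of f x sequentially c]
      complex_subspace_scale[OF assms]
    unfolding closure_sequential by (intro exI[of _ "\<lambda>n. c *\<^sub>C f n"]) auto
qed

section \<open>Geometric sequences\<close>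

lemma bounded_linear_Rep_c0: "bounded_linear (\<lambda>a. Rep_c0 a k)"
  by (rule bounded_linear_intro[of _ 1])
    (auto simp: scaleR_conv_of_real norm_Rep_c0_le)

lemma Rep_c0_sum: "Rep_c0 (sum g I) k = (\<Sum>i\<in>I. Rep_c0 (g i) k)"
  using linear_sum[OF bounded_linear.linear[OF bounded_linear_Rep_c0]] by blast

text \<open>
  The Taylor coefficients of the \<open>c\<^sub>0\<close>-valued function \<open>w \<mapsto> (w\<^sup>k)\<^sub>k\<close>: \<open>geo_coeff w j\<close> is its
  \<open>j\<close>-th derivative at \<open>w\<close> divided by \<open>j!\<close>. In particular \<open>geo_coeff w 0\<close> is the geometric
  sequence itself, and \<open>geo_coeff 0 j\<close> is the \<open>j\<close>-th unit vector.
\<close>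

definition geo_coeff :: "complex \<Rightarrow> nat \<Rightarrow> c0" where
  "geo_coeff w j = Abs_c0 (\<lambda>k. of_nat (k choose j) * w ^ (k - j))"

abbreviation geo :: "complex \<Rightarrow> c0" where
  "geo w \<equiv> geo_coeff w 0"

text \<open>
  The left-hand side times \<open>r\<^sup>j\<close> is one term of the binomial expansion of \<open>(a + r)\<^sup>k\<close>. With
  \<open>a + r < 1\<close> this shows that the Taylor coefficients lie in \<open>c\<^sub>0\<close>, and with \<open>a + r = 1\<close> it
  is Cauchy's estimate for them.
\<close>

lemma choose_power_le:
  assumes "a \<ge> 0" "r > (0::real)"
  shows "of_nat (k choose j) * a ^ (k - j) \<le> (a + r) ^ k / r ^ j"
proof (cases "j \<le> k")
  case True
  have "of_nat (k choose j) * r ^ j * a ^ (k - j) \<le> (\<Sum>i\<le>k. of_nat (k choose i) * r ^ i * a ^ (k - i))"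
    using assms True by (intro member_le_sum) auto
  also have "\<dots> = (a + r) ^ k"
    using binomial_ring[of r a k] by (simp add: add.commute)
  finally show ?thesis
    using assms by (simp add: field_simps)
next
  case False
  then have "k < j" by simp
  then show ?thesis using assms by (simp add: binomial_eq_0)
qed

lemma Rep_geo_coeff:
  assumes "cmod w < 1"
  shows "Rep_c0 (geo_coeff w j) k = of_nat (k choose j) * w ^ (k - j)"
proof -
  define r where "r = (1 - cmod w) / 2"
  have r: "r > 0" "0 \<le> cmod w + r" "cmod w + r < 1"
    using assms by (auto simp: r_def field_simps)
  have "(\<lambda>k. (cmod w + r) ^ k / r ^ j) \<longlonglongrightarrow> 0 / r ^ j"
    using r by (intro tendsto_intros LIMSEQ_realpow_zero) auto
  then have lim: "(\<lambda>k. (cmod w + r) ^ k / r ^ j) \<longlonglongrightarrow> 0" by simp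
  have "norm (of_nat (k choose j) * w ^ (k - j)) \<le> (cmod w + r) ^ k / r ^ j" for k
    using choose_power_le[of "cmod w" r k j] r by (simp add: norm_mult norm_power)
  then have "(\<lambda>k. of_nat (k choose j) * w ^ (k - j)) \<longlonglongrightarrow> 0"
    by (intro Lim_null_comparison[OF always_eventually lim]) blast
  then show ?thesis
    unfolding geo_coeff_def by (simp add: Rep_c0_inverse')
qed

lemma norm_geo_coeff_le:
  assumes "cmod w < 1"
  shows "norm (geo_coeff w j) \<le> (1 / (1 - cmod w)) ^ j"
proof (rule norm_c0_leI)
  fix k
  have "cmod (Rep_c0 (geo_coeff w j) k) \<le> (cmod w + (1 - cmod w)) ^ k / (1 - cmod w) ^ j"
    using choose_power_le[of "cmod w" "1 - cmod w" k j] assms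
    by (simp add: Rep_geo_coeff norm_mult norm_power)
  then show "cmod (Rep_c0 (geo_coeff w j) k) \<le> (1 / (1 - cmod w)) ^ j"
    by (simp add: power_divide)
qed

lemma norm_geo:
  assumes "cmod w < 1"
  shows "norm (geo w) = 1"
  using norm_geo_coeff_le[OF assms, of 0] norm_Rep_c0_le[of "geo w" 0] assms
  by (simp add: Rep_geo_coeff)

lemma geo_taylor_summable:
  assumes "cmod w < 1" "dist v w < 1 - cmod w"
  shows "summable (\<lambda>j. norm ((v - w) ^ j *\<^sub>C geo_coeff w j))"
proof (rule summable_comparison_test')
  show "summable (\<lambda>j. (dist v w / (1 - cmod w)) ^ j)"
    using assms by (intro summable_geometric) auto
  show "norm (norm ((v - w) ^ j *\<^sub>C geo_coeff w j)) \<le> (dist v w / (1 - cmod w)) ^ j" for j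
    using mult_left_mono[OF norm_geo_coeff_le[OF assms(1), of j], of "dist v w ^ j"]
    by (simp add: norm_scaleC norm_power dist_norm power_divide)
qed

text \<open>
  Coordinate by coordinate this is the binomial theorem for \<open>v = (v - w) + w\<close>.
\<close>

lemma geo_taylor_sums:
  assumes "cmod w < 1" "dist v w < 1 - cmod w"
  shows "(\<lambda>j. (v - w) ^ j *\<^sub>C geo_coeff w j) sums geo v"
proof -
  have v: "cmod v < 1"
    using norm_triangle_sub[of v w] assms by (simp add: dist_norm)
  have S: "(\<lambda>j. (v - w) ^ j *\<^sub>C geo_coeff w j) sums (\<Sum>j. (v - w) ^ j *\<^sub>C geo_coeff w j)"
    by (rule summable_sums[OF summable_norm_cancel[OF geo_taylor_summable[OF assms]]])
  have "(\<Sum>j. (v - w) ^ j *\<^sub>C geo_coeff w j) = geo v"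
  proof (rule c0_eqI)
    fix k
    have "(\<lambda>j. (v - w) ^ j * (of_nat (k choose j) * w ^ (k - j)))
        sums (\<Sum>j\<le>k. (v - w) ^ j * (of_nat (k choose j) * w ^ (k - j)))"
      by (rule sums_finite) auto
    also have "(\<Sum>j\<le>k. (v - w) ^ j * (of_nat (k choose j) * w ^ (k - j))) = v ^ k"
      using binomial_ring[of "v - w" w k] by (simp add: mult_ac)
    finally show "Rep_c0 (\<Sum>j. (v - w) ^ j *\<^sub>C geo_coeff w j) k = Rep_c0 (geo v) k"
      using bounded_linear.sums[OF bounded_linear_Rep_c0 S, of k] v assms
      by (simp add: Rep_geo_coeff sums_unique2)
  qed
  with S show ?thesis by simp
qed

text \<open>
  In half the disc of convergence the series is dominated by a geometric one of ratio at most
  \<open>1 / 2\<close>, whose tail is at most twice its first term.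
\<close>

lemma geo_taylor_remainder:
  assumes "cmod w < 1" "dist v w \<le> (1 - cmod w) / 2"
  shows "norm (geo v - (\<Sum>j<N. (v - w) ^ j *\<^sub>C geo_coeff w j))
           \<le> 2 * (dist v w / (1 - cmod w)) ^ N"
proof -
  define q where "q = dist v w / (1 - cmod w)"
  have q: "0 \<le> q" "q \<le> 1/2"
    using assms by (auto simp: q_def field_simps)
  have le: "dist v w < 1 - cmod w"
    using assms by (simp add: field_simps)
  have tail: "(\<lambda>j. (v - w) ^ (j + N) *\<^sub>C geo_coeff w (j + N)) sums
      (geo v - (\<Sum>j<N. (v - w) ^ j *\<^sub>C geo_coeff w j))"
    using sums_split_initial_segment[OF geo_taylor_sums[OF assms(1) le], of N] .
  have geo: "(\<lambda>j. q ^ (j + N)) sums (q ^ N * (1 / (1 - q)))"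
    using sums_mult[OF geometric_sums[of q], of "q ^ N"] q
    by (simp add: power_add mult.commute)
  have b: "norm ((v - w) ^ (j + N) *\<^sub>C geo_coeff w (j + N)) \<le> q ^ (j + N)" for j
    using mult_left_mono[OF norm_geo_coeff_le[OF assms(1), of "j + N"], of "dist v w ^ (j + N)"]
    by (simp add: q_def norm_scaleC norm_power dist_norm power_divide)
  have "norm (geo v - (\<Sum>j<N. (v - w) ^ j *\<^sub>C geo_coeff w j)) \<le> q ^ N * (1 / (1 - q))"
    using norm_sums_le[OF tail geo b] .
  also have "\<dots> \<le> q ^ N * 2"
    using q by (intro mult_left_mono) (auto simp: field_simps)
  finally show ?thesis by (simp add: q_def mult.commute)
qed

text \<open>
  By induction on \<open>n\<close>: the \<open>n\<close>-th Taylor coefficient is the limit, as \<open>v\<close> tends to \<open>w\<close>, of the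
  divided differences \<open>(geo v - \<Sum>j<n. (v - w)\<^sup>j geo_coeff w j) / (v - w)\<^sup>n\<close>, and these lie in
  \<open>Y\<close> for all \<open>v\<close> with \<open>geo v \<in> Y\<close>.
\<close>

lemma geo_coeff_in_closed_subspace:
  assumes Y: "complex_subspace Y" "closed Y" and w: "cmod w < 1"
    and lim: "w islimpt {v. geo v \<in> Y}"
  shows "geo_coeff w n \<in> Y"
proof (induction n rule: less_induct)
  case (less n)
  define r where "r = 1 - cmod w"
  have r: "r > 0" using w by (simp add: r_def)
  have "\<exists>y\<in>Y. dist y (geo_coeff w n) < e" if e: "e > 0" for e
  proof -
    \<comment> \<open>The first bound makes the remainder estimate applicable, the second makes it less than \<open>e\<close>.\<close>
    define d where "d = min (r / 2) (e * r ^ Suc n / 2)"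
    have d: "d > 0" using e r by (simp add: d_def)
    then obtain v where v: "geo v \<in> Y" "v \<noteq> w" "dist v w < d"
      using lim unfolding islimpt_approachable by blast
    define x where "x = geo v - (\<Sum>j<n. (v - w) ^ j *\<^sub>C geo_coeff w j)"
    define y where "y = (1 / (v - w) ^ n) *\<^sub>C x"
    have "x \<in> Y"
      unfolding x_def using less v Y
      by (intro complex_subspace_diff complex_subspace_sum complex_subspace_scale) auto
    then have "y \<in> Y"
      unfolding y_def by (rule complex_subspace_scale[OF Y(1)])
    have "y - geo_coeff w n = (1 / (v - w) ^ n) *\<^sub>C (x - (v - w) ^ n *\<^sub>C geo_coeff w n)"
      using v by (simp add: y_def scaleC_diff_right scaleC_scaleC)
    also have "x - (v - w) ^ n *\<^sub>C geo_coeff w n =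
        geo v - (\<Sum>j<Suc n. (v - w) ^ j *\<^sub>C geo_coeff w j)"
      by (simp add: x_def)
    finally have "norm (y - geo_coeff w n) =
        (1 / dist v w ^ n) * norm (geo v - (\<Sum>j<Suc n. (v - w) ^ j *\<^sub>C geo_coeff w j))"
      by (simp add: norm_scaleC norm_divide norm_power dist_norm)
    also have "\<dots> \<le> (1 / dist v w ^ n) * (2 * (dist v w / r) ^ Suc n)"
      using geo_taylor_remainder[OF w, of v "Suc n"] v
      by (intro mult_left_mono) (auto simp: r_def d_def)
    also have "\<dots> = 2 * dist v w / r ^ Suc n"
      using v r by (simp add: power_divide)
    also have "\<dots> < e"
      using v(3) r by (simp add: d_def pos_divide_less_eq)
    finally show ?thesis
      using \<open>y \<in> Y\<close> by (auto simp: dist_norm)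
  qed
  then show ?case
    using closure_approachable[of "geo_coeff w n" Y] Y by auto
qed

lemma Rep_geo_coeff_at_0: "Rep_c0 (geo_coeff 0 j) k = (if k = j then 1 else 0)"
  by (auto simp: Rep_geo_coeff power_0_left)

lemma closed_subspace_units:
  assumes Y: "complex_subspace Y" "closed Y" and unit: "\<And>j. geo_coeff 0 j \<in> Y"
  shows "Y = UNIV"
proof -
  have "a \<in> Y" for a
  proof -
    have "\<exists>y\<in>Y. dist y a < e" if e: "e > 0" for e
    proof -
      obtain N where N: "\<And>n. n \<ge> N \<Longrightarrow> cmod (Rep_c0 a n) < e / 2"
        using LIMSEQ_D[OF Rep_c0_tendsto[of a], of "e / 2"] e by auto
      define y where "y = (\<Sum>j<N. Rep_c0 a j *\<^sub>C geo_coeff 0 j)"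
      have "y \<in> Y"
        unfolding y_def by (intro complex_subspace_sum complex_subspace_scale Y unit)
      have "Rep_c0 (y - a) k = (if k < N then 0 else - Rep_c0 a k)" for k
        by (simp add: y_def Rep_c0_sum Rep_geo_coeff_at_0 if_distrib if_distribR sum.delta
            cong: if_cong)
      then have "norm (y - a) \<le> e / 2"
        using N e by (intro norm_c0_leI) (auto simp: not_less intro: less_imp_le)
      then show ?thesis
        using \<open>y \<in> Y\<close> e by (intro bexI[of _ y]) (auto simp: dist_norm)
    qed
    then show ?thesis
      using closure_approachable[of a Y] Y by auto
  qed
  then show ?thesis by auto
qed

text \<open>
  This is the identity theorem for \<open>w \<mapsto> geo w\<close> modulo \<open>Y\<close>, proved without functionals. Let
  \<open>L\<close> be the set of limit points of \<open>{v. geo v \<in> Y}\<close> in the disc. At each of them all Taylor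
  coefficients lie in \<open>Y\<close>, hence so does \<open>geo u\<close> for all \<open>u\<close> in the disc of convergence. So
  \<open>L\<close> is open and closed in the unit disc, thus contains 0, where the Taylor coefficients are the
  unit vectors.
\<close>

lemma geo_total:
  assumes Y: "complex_subspace Y" "closed Y" and geo: "\<And>v. v \<in> S \<Longrightarrow> geo v \<in> Y"
    and w: "w islimpt S" "cmod w < 1"
  shows "Y = UNIV"
proof -
  define E where "E = {v. geo v \<in> Y}"
  define L where "L = {v \<in> ball 0 1. v islimpt E}"
  have ball_E: "ball v (1 - cmod v) \<subseteq> E" if v: "v \<in> L" for v
  proof
    fix u assume u: "u \<in> ball v (1 - cmod v)"
    have coeff: "geo_coeff v j \<in> Y" for j
      using geo_coeff_in_closed_subspace[OF Y, of v j] v by (auto simp: L_def E_def)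
    have "(\<lambda>j. (u - v) ^ j *\<^sub>C geo_coeff v j) sums geo u"
      using u v by (intro geo_taylor_sums) (auto simp: L_def dist_commute)
    then have "geo u \<in> closure Y"
      unfolding closure_sequential sums_def using Y coeff
      by (intro exI[of _ "\<lambda>n. \<Sum>j<n. (u - v) ^ j *\<^sub>C geo_coeff v j"])
        (auto intro!: complex_subspace_sum complex_subspace_scale)
    then show "u \<in> E" using Y by (simp add: E_def)
  qed
  have "open L"
    unfolding open_contains_ball
  proof
    fix v assume v: "v \<in> L"
    show "\<exists>e>0. ball v e \<subseteq> L"
    proof (intro exI[of _ "1 - cmod v"] conjI subsetI)
      show "0 < 1 - cmod v" using v by (simp add: L_def)
      fix u assume u: "u \<in> ball v (1 - cmod v)"
      then have "u islimpt ball v (1 - cmod v)"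
        by (simp add: interior_limit_point)
      then have "u islimpt E" using ball_E[OF v] islimpt_subset by blast
      moreover have "cmod u < 1"
        using u norm_triangle_sub[of u v] by (simp add: dist_norm norm_minus_commute)
      ultimately show "u \<in> L" by (simp add: L_def)
    qed
  qed
  then have "openin (top_of_set (ball 0 1)) L"
    by (auto simp: openin_open L_def)
  moreover have "closedin (top_of_set (ball 0 1)) L"
    using closed_limpts[of E] unfolding closedin_closed L_def by blast
  moreover have "w \<in> L"
    using w geo islimpt_subset[of w S E] by (auto simp: L_def E_def)
  ultimately have "L = ball 0 1"
    using connected_clopen[of "ball (0::complex) 1"] by auto
  then have "0 \<in> L" by simp
  then have "geo_coeff 0 j \<in> Y" for j
    using geo_coeff_in_closed_subspace[OF Y, of 0 j] by (auto simp: L_def E_def)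
  then show ?thesis by (rule closed_subspace_units[OF Y])
qed

section \<open>The Riesz--Dunford calculus on eigenvectors\<close>

abbreviation op_power :: "('a::real_normed_vector \<Rightarrow>\<^sub>L 'a) \<Rightarrow> nat \<Rightarrow> ('a \<Rightarrow>\<^sub>L 'a)" where
  "op_power A n \<equiv> ((o\<^sub>L) A ^^ n) id_blinfun"

lemma norm_op_power_le:
  assumes "norm A \<le> \<rho>"
  shows "norm (op_power A n) \<le> \<rho> ^ n"
proof (induction n)
  case 0
  show ?case by (simp add: norm_blinfun_id_le)
next
  case (Suc n)
  have "norm (op_power A (Suc n)) \<le> norm A * norm (op_power A n)"
    by (simp add: norm_blinfun_compose)
  also have "\<dots> \<le> \<rho> * \<rho> ^ n"
    using assms Suc order_trans[OF norm_ge_zero assms] by (intro mult_mono) auto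
  finally show ?case by simp
qed

lemma norm_scalar_op_le: "norm (scalar_op c) \<le> cmod c"
  by (rule norm_blinfun_bound) (auto simp: norm_scaleC)

lemma norm_scalar_op_compose_le: "norm (scalar_op c o\<^sub>L A) \<le> cmod c * norm A"
  using norm_blinfun_compose[of "scalar_op c" A] norm_scalar_op_le[of c]
  by (meson mult_right_mono norm_ge_zero order_trans)

lemma bounded_linear_scalar_op_compose:
  "bounded_linear (\<lambda>c. scalar_op c o\<^sub>L (A :: 'b::real_normed_vector \<Rightarrow>\<^sub>L 'a::complex_banach))"
proof (rule bounded_linear_intro)
  show "scalar_op (c + d) o\<^sub>L A = (scalar_op c o\<^sub>L A) + (scalar_op d o\<^sub>L A)" for c d
    by (rule blinfun_eqI) (simp add: blinfun.add_left scaleC_add_left)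
  show "scalar_op (r *\<^sub>R c) o\<^sub>L A = r *\<^sub>R (scalar_op c o\<^sub>L A)" for r c
    by (rule blinfun_eqI)
      (simp add: blinfun.scaleR_left scaleR_eq_scaleC scaleC_scaleC scaleR_conv_of_real)
  show "norm (scalar_op c o\<^sub>L A) \<le> norm c * norm A" for c
    using norm_blinfun_compose[of "scalar_op c" A]
      mult_right_mono[OF norm_blinfun_bound[of "cmod c" "scalar_op c :: 'a \<Rightarrow>\<^sub>L 'a"], of "norm A"]
    by (simp add: norm_scaleC)
qed

lemma op_inverse_unique:
  assumes "is_op_inverse A B" "is_op_inverse A C"
  shows "B = C"
proof -
  have "B x = C x" for x
  proof -
    have "B x = B ((A o\<^sub>L C) x)" using assms by (simp add: is_op_inverse_def)
    also have "\<dots> = (B o\<^sub>L A) (C x)" by simp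
    also have "\<dots> = C x" using assms by (simp add: is_op_inverse_def del: blinfun_apply_blinfun_compose)
    finally show ?thesis .
  qed
  then show ?thesis by (rule blinfun_eqI)
qed

lemma resolvent_eqI: "is_op_inverse (scalar_op z - A) B \<Longrightarrow> resolvent A z = B"
  unfolding resolvent_def by (rule the_equality) (auto intro: op_inverse_unique)

text \<open>
  The type of bounded operators only provides real-linearity.
\<close>

definition complex_linear_op :: "('a::complex_banach \<Rightarrow>\<^sub>L 'a) \<Rightarrow> bool" where
  "complex_linear_op A \<longleftrightarrow> (\<forall>c x. A (c *\<^sub>C x) = c *\<^sub>C A x)"

lemma complex_linear_op_power:
  assumes "complex_linear_op A"
  shows "op_power A n (c *\<^sub>C x) = c *\<^sub>C op_power A n x"
  using assms by (induction n) (auto simp: complex_linear_op_def)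

lemma op_power_commute: "op_power A n (A x) = A (op_power A n x)"
  by (induction n) auto

definition neumann_term :: "('a::complex_banach \<Rightarrow>\<^sub>L 'a) \<Rightarrow> complex \<Rightarrow> nat \<Rightarrow> ('a \<Rightarrow>\<^sub>L 'a)" where
  "neumann_term A z n = scalar_op (1 / z ^ Suc n) o\<^sub>L op_power A n"

text \<open>
  The products telescope; this is the geometric sum for \<open>1 / (z - A)\<close> with its exact remainder.
\<close>

lemma neumann_partial_sum:
  assumes A: "complex_linear_op A" and z: "z \<noteq> 0"
  shows "(scalar_op z - A) o\<^sub>L (\<Sum>i<n. neumann_term A z i) =
           id_blinfun - (scalar_op (1 / z ^ n) o\<^sub>L op_power A n)" (is ?L)
    and "(\<Sum>i<n. neumann_term A z i) o\<^sub>L (scalar_op z - A) =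
           id_blinfun - (scalar_op (1 / z ^ n) o\<^sub>L op_power A n)" (is ?R)
proof -
  have Ac: "A (c *\<^sub>C x) = c *\<^sub>C A x" for c x
    using A by (simp add: complex_linear_op_def)
  have "blinfun_apply ((scalar_op z - A) o\<^sub>L (\<Sum>i<n. neumann_term A z i)) x =
        x - (1 / z ^ n) *\<^sub>C op_power A n x \<and>
        blinfun_apply ((\<Sum>i<n. neumann_term A z i) o\<^sub>L (scalar_op z - A)) x =
        x - (1 / z ^ n) *\<^sub>C op_power A n x" for x
  proof (induction n)
    case 0
    show ?case by simp
  next
    case (Suc n)
    have "(scalar_op z - A) (neumann_term A z n x) =
        (1 / z ^ n) *\<^sub>C op_power A n x - (1 / z ^ Suc n) *\<^sub>C op_power A (Suc n) x"
      using z by (simp add: neumann_term_def blinfun.diff_left scaleC_scaleC Ac)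
    moreover have "neumann_term A z n ((scalar_op z - A) x) =
        (1 / z ^ n) *\<^sub>C op_power A n x - (1 / z ^ Suc n) *\<^sub>C op_power A (Suc n) x"
      using z by (simp add: neumann_term_def blinfun.diff_left blinfun.diff_right scaleC_diff_right
          scaleC_scaleC complex_linear_op_power[OF A] op_power_commute)
    ultimately show ?case
      using Suc by (simp add: blinfun.add_right blinfun.add_left)
  qed
  then show ?L ?R
    by (auto intro!: blinfun_eqI simp: blinfun.diff_left)
qed

text \<open>
  The second part bounds the tail of the series uniformly in \<open>\<bar>z\<bar> \<ge> r\<close>, which is what allows to
  integrate it term by term.
\<close>

lemma neumann_series:
  assumes A: "complex_linear_op A" "norm A \<le> \<rho>" and z: "\<rho> < cmod z"
  shows "is_op_inverse (scalar_op z - A) (resolvent A z)"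
    and "\<rho> < r \<Longrightarrow> r \<le> cmod z \<Longrightarrow>
           norm ((\<Sum>i<n. neumann_term A z i) - resolvent A z) \<le> (\<rho> / r) ^ n * (1 / (r - \<rho>))"
proof -
  have \<rho>: "0 \<le> \<rho>" using A(2) norm_ge_zero order_trans by blast
  have z0: "z \<noteq> 0" using z \<rho> by auto
  have b: "norm (neumann_term A z n) \<le> (\<rho> / r) ^ n * (1 / r)" if "\<rho> < r" "r \<le> cmod z" for n r
  proof -
    have "norm (neumann_term A z n) \<le> cmod (1 / z ^ Suc n) * norm (op_power A n)"
      unfolding neumann_term_def by (rule norm_scalar_op_compose_le)
    also have "\<dots> \<le> cmod (1 / z ^ Suc n) * \<rho> ^ n"
      by (rule mult_left_mono[OF norm_op_power_le[OF A(2)]]) simp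
    also have "\<dots> = 1 / cmod z ^ Suc n * \<rho> ^ n"
      by (simp add: norm_divide norm_mult norm_power)
    also have "\<dots> \<le> 1 / r ^ Suc n * \<rho> ^ n"
    proof (intro mult_right_mono frac_le)
      show "r ^ Suc n \<le> cmod z ^ Suc n" using that \<rho> by (intro power_mono) auto
      show "0 < r ^ Suc n" using that \<rho> by (intro zero_less_power) linarith
    qed (use \<rho> in auto)
    also have "\<dots> = (\<rho> / r) ^ n * (1 / r)" by (simp add: power_divide)
    finally show ?thesis .
  qed
  have geo: "(\<lambda>i. (\<rho> / r) ^ (i + n) * (1 / r)) sums ((\<rho> / r) ^ n * (1 / (r - \<rho>)))"
    if "\<rho> < r" for n r
  proof -
    have "(\<lambda>i. ((\<rho> / r) ^ n * (1 / r)) * (\<rho> / r) ^ i) sums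
        (((\<rho> / r) ^ n * (1 / r)) * (1 / (1 - \<rho> / r)))"
      using that \<rho> by (intro sums_mult geometric_sums) auto
    moreover have "(1 / r) * (1 / (1 - \<rho> / r)) = 1 / (r - \<rho>)"
      using that \<rho> by (simp add: field_simps)
    then have "((\<rho> / r) ^ n * (1 / r)) * (1 / (1 - \<rho> / r)) = (\<rho> / r) ^ n * (1 / (r - \<rho>))"
      by (simp only: mult.assoc)
    moreover have "(\<lambda>i. ((\<rho> / r) ^ n * (1 / r)) * (\<rho> / r) ^ i) = (\<lambda>i. (\<rho> / r) ^ (i + n) * (1 / r))"
      by (simp add: power_add fun_eq_iff)
    ultimately show ?thesis by (simp only:)
  qed
  have "summable (neumann_term A z)"
  proof (rule summable_comparison_test')
    show "summable (\<lambda>n. (\<rho> / cmod z) ^ (n + 0) * (1 / cmod z))"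
      by (rule sums_summable[OF geo[OF z]])
    show "norm (neumann_term A z n) \<le> (\<rho> / cmod z) ^ (n + 0) * (1 / cmod z)" for n
      using b[OF z, of n] by simp
  qed
  then obtain N where N: "neumann_term A z sums N"
    by (auto simp: summable_def)
  have zero: "(\<lambda>n. scalar_op (1 / z ^ n) o\<^sub>L op_power A n) \<longlonglongrightarrow> 0"
  proof (rule Lim_null_comparison)
    show "(\<lambda>n. (\<rho> / cmod z) ^ n) \<longlonglongrightarrow> 0"
      using z \<rho> by (intro LIMSEQ_realpow_zero) (auto simp: divide_less_eq_1)
    show "\<forall>\<^sub>F n in sequentially. norm (scalar_op (1 / z ^ n) o\<^sub>L op_power A n) \<le> (\<rho> / cmod z) ^ n"
    proof (rule always_eventually, rule allI)
      fix n
      have "norm (scalar_op (1 / z ^ n) o\<^sub>L op_power A n) \<le> cmod (1 / z ^ n) * norm (op_power A n)"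
        by (rule norm_scalar_op_compose_le)
      also have "\<dots> \<le> cmod (1 / z ^ n) * \<rho> ^ n"
        by (rule mult_left_mono[OF norm_op_power_le[OF A(2)]]) simp
      finally have "norm (scalar_op (1 / z ^ n) o\<^sub>L op_power A n) \<le> cmod (1 / z ^ n) * \<rho> ^ n" .
      then show "norm (scalar_op (1 / z ^ n) o\<^sub>L op_power A n) \<le> (\<rho> / cmod z) ^ n"
        by (simp add: norm_divide norm_power power_divide)
    qed
  qed
  then have one: "(\<lambda>n. id_blinfun - (scalar_op (1 / z ^ n) o\<^sub>L op_power A n)) \<longlonglongrightarrow> id_blinfun"
    using tendsto_diff[OF tendsto_const zero] by simp
  have S: "(\<lambda>n. \<Sum>i<n. neumann_term A z i) \<longlonglongrightarrow> N"
    using N by (simp add: sums_def)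
  have "(scalar_op z - A) o\<^sub>L N = id_blinfun"
    using LIMSEQ_unique[OF bounded_linear.tendsto[OF bounded_bilinear.bounded_linear_right[OF bounded_bilinear_blinfun_compose, of "scalar_op z - A"] S]] one
    by (simp add: neumann_partial_sum[OF A(1) z0])
  moreover have "N o\<^sub>L (scalar_op z - A) = id_blinfun"
    using LIMSEQ_unique[OF bounded_linear.tendsto[OF bounded_bilinear.bounded_linear_left[OF bounded_bilinear_blinfun_compose, of "scalar_op z - A"] S]] one
    by (simp add: neumann_partial_sum[OF A(1) z0])
  ultimately have inv: "is_op_inverse (scalar_op z - A) N"
    by (simp add: is_op_inverse_def)
  then have R: "resolvent A z = N" by (rule resolvent_eqI)
  show "is_op_inverse (scalar_op z - A) (resolvent A z)" using inv R by simp
  assume r: "\<rho> < r" "r \<le> cmod z"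
  have "norm (N - (\<Sum>i<n. neumann_term A z i)) \<le> (\<rho> / r) ^ n * (1 / (r - \<rho>))"
    by (rule norm_sums_le[OF sums_split_initial_segment[OF N] geo[OF r(1)] b[OF r]])
  then show "norm ((\<Sum>i<n. neumann_term A z i) - resolvent A z) \<le> (\<rho> / r) ^ n * (1 / (r - \<rho>))"
    by (simp add: R norm_minus_commute)
qed

text \<open>
  Each summand \<open>f z / z\<^bsup>n+1\<^esup> A\<^sup>n\<close> of \<open>f z (z - A)\<^sup>-\<^sup>1\<close> is a scalar holomorphic function times a
  constant operator, so it has a local primitive. The primitives are normalised to vanish at the
  centre \<open>x\<close>; then the series of primitives converges at \<open>x\<close>, and uniform convergence of the
  derivatives makes its sum a primitive of the whole function.
\<close>

lemma resolvent_local_primitive: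
  assumes A: "complex_linear_op A" "norm A \<le> \<rho>"
    and f: "f holomorphic_on U" "open U" and x: "x \<in> U" "\<rho> < cmod x"
  shows "\<exists>\<delta>>0. \<exists>H. \<forall>z\<in>ball x \<delta>.
           (H has_derivative (\<lambda>h. scalar_op h o\<^sub>L (scalar_op (f z) o\<^sub>L resolvent A z))) (at z)"
proof -
  have \<rho>: "0 \<le> \<rho>" using A(2) norm_ge_zero order_trans by blast
  obtain \<delta>0 where \<delta>0: "\<delta>0 > 0" "cball x \<delta>0 \<subseteq> U"
    using f(2) x(1) open_contains_cball by blast
  \<comment> \<open>The disc of radius \<open>\<delta>\<close> around \<open>x\<close> stays outside the circle of radius \<open>r > \<rho>\<close>.\<close>
  define \<delta> where "\<delta> = min \<delta>0 ((cmod x - \<rho>) / 2)"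
  define r where "r = (cmod x + \<rho>) / 2"
  have \<delta>: "\<delta> > 0" "cball x \<delta> \<subseteq> U" and r: "\<rho> < r"
    using \<delta>0 x by (auto simp: \<delta>_def r_def)
  have zr: "r \<le> cmod z" if "z \<in> ball x \<delta>" for z
  proof -
    have "cmod (x - z) \<le> (cmod x - \<rho>) / 2" using that by (auto simp: \<delta>_def dist_norm)
    then show ?thesis using norm_triangle_sub[of x z] by (simp add: r_def field_simps)
  qed
  have "compact (f ` cball x \<delta>)"
    using \<delta> f by (intro compact_continuous_image holomorphic_on_imp_continuous_on)
      (auto intro: holomorphic_on_subset)
  then obtain B where B: "B > 0" "\<And>z. z \<in> cball x \<delta> \<Longrightarrow> cmod (f z) \<le> B"
    using compact_imp_bounded[of "f ` cball x \<delta>"] unfolding bounded_pos by blast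
  have "\<exists>P. P x = 0 \<and> (\<forall>z\<in>ball x \<delta>. (P has_field_derivative f z / z ^ Suc n) (at z))" for n
  proof -
    have "(\<lambda>z. f z / z ^ Suc n) holomorphic_on ball x \<delta>"
    proof (intro holomorphic_intros)
      show "f holomorphic_on ball x \<delta>"
        using f(1) \<delta>(2) ball_subset_cball holomorphic_on_subset by (metis subset_trans)
      show "z ^ Suc n \<noteq> 0" if "z \<in> ball x \<delta>" for z
        using zr[OF that] r \<rho> by auto
    qed
    then obtain g where "\<And>z. z \<in> ball x \<delta> \<Longrightarrow>
        (g has_field_derivative f z / z ^ Suc n) (at z within ball x \<delta>)"
      using holomorphic_convex_primitive'[OF convex_ball open_ball] by blast
    then have g: "(g has_field_derivative f z / z ^ Suc n) (at z)" if "z \<in> ball x \<delta>" for z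
      using at_within_open[OF that open_ball] that by metis
    have "((\<lambda>z. g z - g x) has_field_derivative f z / z ^ Suc n) (at z)" if "z \<in> ball x \<delta>" for z
      using DERIV_diff[OF g[OF that] DERIV_const[of "g x"]] by simp
    then show ?thesis
      by (intro exI[of _ "\<lambda>z. g z - g x"]) simp
  qed
  then obtain P where P: "\<And>n. P n x = 0"
    "\<And>n z. z \<in> ball x \<delta> \<Longrightarrow> (P n has_field_derivative f z / z ^ Suc n) (at z)"
    by metis
  have "\<exists>H. \<forall>z\<in>ball x \<delta>. (\<lambda>n. scalar_op (P n z) o\<^sub>L op_power A n) sums H z \<and>
      (H has_derivative (\<lambda>h. scalar_op h o\<^sub>L (scalar_op (f z) o\<^sub>L resolvent A z))) (at z within ball x \<delta>)"
  proof (rule has_derivative_series[OF convex_ball, where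
        f' = "\<lambda>n z h. scalar_op (f z / z ^ Suc n * h) o\<^sub>L op_power A n" and x = x and l = 0])
    fix n z assume z: "z \<in> ball x \<delta>"
    have "(P n has_derivative (\<lambda>h. f z / z ^ Suc n * h)) (at z within ball x \<delta>)"
      using P(2)[OF z, of n] unfolding has_field_derivative_def
      by (rule has_derivative_at_withinI)
    then show "((\<lambda>z. scalar_op (P n z) o\<^sub>L op_power A n) has_derivative
        (\<lambda>h. scalar_op (f z / z ^ Suc n * h) o\<^sub>L op_power A n)) (at z within ball x \<delta>)"
      by (rule bounded_linear.has_derivative[OF bounded_linear_scalar_op_compose])
  next
    fix e :: real assume e: "e > 0"
    have "(\<lambda>n. B * ((\<rho> / r) ^ n * (1 / (r - \<rho>)))) \<longlonglongrightarrow> B * (0 * (1 / (r - \<rho>)))"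
      using r \<rho> by (intro tendsto_intros LIMSEQ_realpow_zero) auto
    then have "\<forall>\<^sub>F n in sequentially. B * ((\<rho> / r) ^ n * (1 / (r - \<rho>))) < e"
      using e by (intro order_tendstoD) auto
    then show "\<forall>\<^sub>F n in sequentially. \<forall>z\<in>ball x \<delta>. \<forall>h.
        norm ((\<Sum>i<n. scalar_op (f z / z ^ Suc i * h) o\<^sub>L op_power A i) -
          (scalar_op h o\<^sub>L (scalar_op (f z) o\<^sub>L resolvent A z))) \<le> e * norm h"
    proof (rule eventually_mono, intro ballI allI)
      fix n z h
      assume n: "B * ((\<rho> / r) ^ n * (1 / (r - \<rho>))) < e" and z: "z \<in> ball x \<delta>"
      define D where "D = (\<Sum>i<n. neumann_term A z i) - resolvent A z"
      have z\<rho>: "\<rho> < cmod z" using zr[OF z] r by simp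
      have D: "norm D \<le> (\<rho> / r) ^ n * (1 / (r - \<rho>))"
        unfolding D_def by (rule neumann_series(2)[OF A z\<rho> r zr[OF z]])
      have "(\<Sum>i<n. scalar_op (f z / z ^ Suc i * h) o\<^sub>L op_power A i) =
          scalar_op (h * f z) o\<^sub>L (\<Sum>i<n. neumann_term A z i)"
        unfolding linear_sum[OF bounded_linear.linear[OF bounded_bilinear.bounded_linear_right[OF bounded_bilinear_blinfun_compose]]]
        by (intro sum.cong refl blinfun_eqI)
          (simp add: neumann_term_def scaleC_scaleC mult_ac)
      then have "(\<Sum>i<n. scalar_op (f z / z ^ Suc i * h) o\<^sub>L op_power A i) -
          (scalar_op h o\<^sub>L (scalar_op (f z) o\<^sub>L resolvent A z)) = scalar_op (h * f z) o\<^sub>L D"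
        by (intro blinfun_eqI)
          (simp add: D_def blinfun.diff_left scaleC_scaleC scaleC_diff_right)
      then have "norm ((\<Sum>i<n. scalar_op (f z / z ^ Suc i * h) o\<^sub>L op_power A i) -
          (scalar_op h o\<^sub>L (scalar_op (f z) o\<^sub>L resolvent A z))) \<le> cmod (h * f z) * norm D"
        using norm_scalar_op_compose_le by metis
      also have "\<dots> \<le> (cmod h * B) * ((\<rho> / r) ^ n * (1 / (r - \<rho>)))"
        using B(2)[of z] z D B(1) by (intro mult_mono) (auto simp: norm_mult intro!: mult_left_mono)
      also have "\<dots> = cmod h * (B * ((\<rho> / r) ^ n * (1 / (r - \<rho>))))"
        by (simp only: mult_ac)
      also have "\<dots> \<le> cmod h * e"
        using n by (intro mult_left_mono) auto
      finally show "norm ((\<Sum>i<n. scalar_op (f z / z ^ Suc i * h) o\<^sub>L op_power A i) -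
          (scalar_op h o\<^sub>L (scalar_op (f z) o\<^sub>L resolvent A z))) \<le> e * norm h"
        by (simp add: mult.commute)
    qed
  next
    show "x \<in> ball x \<delta>" using \<delta> by simp
    have "scalar_op 0 o\<^sub>L op_power A n = 0" for n
      by (rule blinfun_eqI) simp
    then show "(\<lambda>n. scalar_op (P n x) o\<^sub>L op_power A n) sums 0"
      by (simp add: P(1))
  qed
  then obtain H where H: "\<And>z. z \<in> ball x \<delta> \<Longrightarrow>
      (H has_derivative (\<lambda>h. scalar_op h o\<^sub>L (scalar_op (f z) o\<^sub>L resolvent A z))) (at z within ball x \<delta>)"
    by blast
  have "(H has_derivative (\<lambda>h. scalar_op h o\<^sub>L (scalar_op (f z) o\<^sub>L resolvent A z))) (at z)"
    if "z \<in> ball x \<delta>" for z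
    using H[OF that] unfolding at_within_open[OF that open_ball] .
  then show ?thesis
    using \<delta>(1) by blast
qed

text \<open>
  A valid path may have an unbounded derivative, even one that is not absolutely integrable, near
  the finitely many points where it is not differentiable, so boundedness and continuity of the
  integrand cannot be used. The integrand is instead, piece by piece, the derivative of the
  continuous function \<open>H \<circ> \<gamma>\<close> off a finite set, where \<open>H\<close> is a local primitive of \<open>G\<close>.
\<close>

lemma op_contour_integrable:
  fixes G :: "complex \<Rightarrow> ('a::complex_banach \<Rightarrow>\<^sub>L 'a)"
  assumes \<gamma>: "valid_path \<gamma>"
    and prim: "\<And>x. x \<in> path_image \<gamma> \<Longrightarrow>
      \<exists>\<delta>>0. \<exists>H. \<forall>z\<in>ball x \<delta>. (H has_derivative (\<lambda>h. scalar_op h o\<^sub>L G z)) (at z)"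
  shows "(\<lambda>t. scalar_op (vector_derivative \<gamma> (at t within {0..1})) o\<^sub>L G (\<gamma> t)) integrable_on {0..1}"
proof -
  let ?F = "\<lambda>t. scalar_op (vector_derivative \<gamma> (at t within {0..1})) o\<^sub>L G (\<gamma> t)"
  obtain S where S: "finite S" "\<gamma> C1_differentiable_on {0..1} - S"
    and cont: "continuous_on {0..1} \<gamma>"
    using \<gamma> by (auto simp: valid_path_def piecewise_C1_differentiable_on_def)
  have "\<exists>d>0. \<forall>u v. t \<in> cbox u v \<and> cbox u v \<subseteq> ball t d \<and> cbox u v \<subseteq> cbox 0 1 \<longrightarrow>
      ?F integrable_on cbox u v" if t: "t \<in> cbox 0 1" for t
  proof -
    have "\<gamma> t \<in> path_image \<gamma>" using t by (auto simp: path_image_def)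
    then obtain \<delta> H where \<delta>: "\<delta> > 0"
      and H: "\<And>z. z \<in> ball (\<gamma> t) \<delta> \<Longrightarrow> (H has_derivative (\<lambda>h. scalar_op h o\<^sub>L G z)) (at z)"
      using prim by metis
    obtain d where d: "d > 0" "\<And>s. s \<in> {0..1} \<Longrightarrow> dist s t < d \<Longrightarrow> dist (\<gamma> s) (\<gamma> t) < \<delta>"
      using cont t \<delta> unfolding continuous_on_iff by (metis cbox_interval)
    have "?F integrable_on cbox u v"
      if uv: "t \<in> cbox u v" "cbox u v \<subseteq> ball t d" "cbox u v \<subseteq> cbox 0 1" for u v
    proof -
      have le: "u \<le> v" using uv(1) by auto
      have in_ball: "\<gamma> s \<in> ball (\<gamma> t) \<delta>" if "s \<in> {u..v}" for s
        using d(2)[of s] uv(2,3) that by (auto simp: dist_commute subset_iff)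
      have "(?F has_integral (H \<circ> \<gamma>) v - (H \<circ> \<gamma>) u) {u..v}"
      proof (rule fundamental_theorem_of_calculus_interior_strong[OF S(1) le])
        fix s assume s: "s \<in> {u<..<v} - S"
        then have s01: "s \<in> {0..1}" using uv(3) by (auto simp: subset_iff)
        obtain g' where g': "(\<gamma> has_vector_derivative g') (at s)"
          using S(2) s s01 unfolding C1_differentiable_on_def by blast
        have eq: "vector_derivative \<gamma> (at s within {0..1}) = g'"
          using g' s01 by (intro vector_derivative_at_within_ivl) auto
        have "(H \<circ> \<gamma> has_derivative ((\<lambda>h. scalar_op h o\<^sub>L G (\<gamma> s)) \<circ> (\<lambda>h. h *\<^sub>R g'))) (at s)"
          using g' H[OF in_ball[of s]] s
          by (intro diff_chain_at) (auto simp: has_vector_derivative_def)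
        moreover have "scalar_op (h *\<^sub>R g') o\<^sub>L G (\<gamma> s) = h *\<^sub>R (scalar_op g' o\<^sub>L G (\<gamma> s))" for h
          by (rule linear_scale[OF bounded_linear.linear[OF bounded_linear_scalar_op_compose]])
        ultimately show "(H \<circ> \<gamma> has_vector_derivative ?F s) (at s)"
          by (simp add: has_vector_derivative_def o_def eq)
      next
        have "continuous_on (ball (\<gamma> t) \<delta>) H"
          using H by (meson continuous_at_imp_continuous_on has_derivative_continuous)
        then show "continuous_on {u..v} (H \<circ> \<gamma>)"
          using in_ball uv(3) cont
          by (intro continuous_on_compose) (auto intro: continuous_on_subset)
      qed
      then show ?thesis by (auto simp: cbox_interval)
    qed
    then show ?thesis using d(1) by blast
  qed
  then have "?F integrable_on cbox 0 1"
    by (intro integrable_on_little_subintervals) blast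
  then show ?thesis by (simp add: cbox_interval)
qed

lemma ex_larger_ball:
  assumes "open U" "cball 0 \<rho> \<subseteq> U" "0 < \<rho>"
  obtains R where "\<rho> < R" "ball (0::complex) R \<subseteq> U"
proof -
  obtain e where e: "e > 0" "(\<Union>x\<in>cball 0 \<rho>. ball x e) \<subseteq> U"
    using compact_subset_open_imp_ball_epsilon_subset[OF compact_cball assms(1,2)] by metis
  have "ball 0 (\<rho> + e) \<subseteq> U"
  proof
    fix z :: complex assume z: "z \<in> ball 0 (\<rho> + e)"
    show "z \<in> U"
    proof (cases "cmod z \<le> \<rho>")
      case True
      then show ?thesis using assms(2) by auto
    next
      case False
      define x where "x = of_real (\<rho> / cmod z) * z"
      have x: "cmod x = \<rho>" using False assms(3) by (auto simp: x_def norm_mult norm_divide)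
      have "z - x = of_real (1 - \<rho> / cmod z) * z"
        by (simp add: x_def algebra_simps)
      then have "cmod (z - x) = \<bar>1 - \<rho> / cmod z\<bar> * cmod z"
        by (simp only: norm_mult norm_of_real)
      moreover have "0 \<le> 1 - \<rho> / cmod z" using False assms(3) by (auto simp: divide_le_eq_1)
      ultimately have "cmod (z - x) = (1 - \<rho> / cmod z) * cmod z" by (simp only: abs_of_nonneg)
      then have "cmod (z - x) = cmod z - \<rho>"
        using False assms(3) by (auto simp: left_diff_distrib)
      then have "x \<in> cball 0 \<rho>" "z \<in> ball x e"
        using x z by (auto simp: dist_norm norm_minus_commute)
      then show ?thesis using e(2) by blast
    qed
  qed
  then show ?thesis using that[of "\<rho> + e"] e(1) by simp
qed

lemma ex_dunford_contour:
  assumes f: "f holomorphic_on U" "open U" "cball 0 \<rho> \<subseteq> U" and \<rho>: "0 < \<rho>"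
    and spec: "op_spectrum A = cball 0 \<rho>"
  shows "\<exists>\<gamma>. dunford_contour f A \<gamma>"
proof -
  obtain R where R: "\<rho> < R" "ball (0::complex) R \<subseteq> U"
    using ex_larger_ball[OF f(2,3) \<rho>] by blast
  define r where "r = (\<rho> + R) / 2"
  have r: "\<rho> < r" "r < R" using R by (auto simp: r_def)
  have "dunford_contour f A (circlepath 0 r)"
    unfolding dunford_contour_def spec
  proof (intro exI[of _ "ball 0 R"] conjI ballI allI impI)
    show "f holomorphic_on ball 0 R" using f(1) R(2) holomorphic_on_subset by blast
    show "path_image (circlepath 0 r) \<subseteq> ball 0 R - cball 0 \<rho>"
      using r \<rho> by (auto simp: path_image_circlepath)
    fix z :: complex
    show "winding_number (circlepath 0 r) z = 1" if "z \<in> cball 0 \<rho>"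
      using that r by (intro winding_number_circlepath) (auto simp: dist_norm)
    show "winding_number (circlepath 0 r) z = 0" if "z \<notin> ball 0 R"
      using that r \<rho> by (intro winding_number_zero_outside[of _ "cball 0 r"])
        (auto simp: path_image_circlepath)
  qed (use R r in \<open>auto simp: valid_path_circlepath\<close>)
  then show ?thesis by blast
qed

text \<open>
  On the complex line of the eigenvector \<open>e\<close> the resolvent is multiplication by \<open>1 / (z - \<mu>)\<close>, so
  that the operator integral becomes the scalar integral of Cauchy's formula. This needs the exact
  spectrum: it ensures that \<open>\<mu>\<close> is surrounded once by every contour that the definition admits.
\<close>

theorem riesz_dunford_eigenvector:
  assumes A: "complex_linear_op A" "norm A \<le> \<rho>" "op_spectrum A = cball 0 \<rho>" and \<rho>: "0 < \<rho>"
    and f: "f holomorphic_on U" "open U" "cball 0 \<rho> \<subseteq> U"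
    and e: "A e = \<mu> *\<^sub>C e" "cmod \<mu> \<le> \<rho>"
  shows "riesz_dunford f A (c *\<^sub>C e) = (c * f \<mu>) *\<^sub>C e"
proof -
  define \<gamma> where "\<gamma> = (SOME \<gamma>. dunford_contour f A \<gamma>)"
  have "dunford_contour f A \<gamma>"
    unfolding \<gamma>_def using ex_dunford_contour[OF f \<rho> A(3)] by (rule someI_ex)
  then obtain V where V: "open V" "cball 0 \<rho> \<subseteq> V" "f holomorphic_on V"
    and \<gamma>: "valid_path \<gamma>" "pathfinish \<gamma> = pathstart \<gamma>" "path_image \<gamma> \<subseteq> V - cball 0 \<rho>"
    and wind: "\<And>z. z \<in> cball 0 \<rho> \<Longrightarrow> winding_number \<gamma> z = 1"
      "\<And>z. z \<notin> V \<Longrightarrow> winding_number \<gamma> z = 0"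
    unfolding dunford_contour_def A(3) by blast
  define G where "G z = scalar_op (f z) o\<^sub>L resolvent A z" for z
  let ?d = "\<lambda>t. vector_derivative \<gamma> (at t within {0..1})"
  have int: "(\<lambda>t. scalar_op (?d t) o\<^sub>L G (\<gamma> t)) integrable_on {0..1}"
    unfolding G_def
  proof (rule op_contour_integrable[OF \<gamma>(1)])
    fix x assume "x \<in> path_image \<gamma>"
    then show "\<exists>\<delta>>0. \<exists>H. \<forall>z\<in>ball x \<delta>.
        (H has_derivative (\<lambda>h. scalar_op h o\<^sub>L (scalar_op (f z) o\<^sub>L resolvent A z))) (at z)"
      using \<gamma>(3) by (intro resolvent_local_primitive[OF A(1,2) V(3,1)]) auto
  qed
  have res: "resolvent A z (c *\<^sub>C e) = (c / (z - \<mu>)) *\<^sub>C e" if z: "\<rho> < cmod z" for z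
  proof -
    have "z \<noteq> \<mu>" using z e(2) by auto
    have "(scalar_op z - A) (d *\<^sub>C e) = (d * (z - \<mu>)) *\<^sub>C e" for d
      using A(1) e(1)
      by (simp add: complex_linear_op_def blinfun.diff_left scaleC_scaleC right_diff_distrib
          mult.commute scaleC_diff_left)
    from this[of "c / (z - \<mu>)"]
      \<open>z \<noteq> \<mu>\<close> have "(scalar_op z - A) ((c / (z - \<mu>)) *\<^sub>C e) = c *\<^sub>C e"
      by simp
    then have "resolvent A z (c *\<^sub>C e) =
        (resolvent A z o\<^sub>L (scalar_op z - A)) ((c / (z - \<mu>)) *\<^sub>C e)"
      by simp
    also have "\<dots> = (c / (z - \<mu>)) *\<^sub>C e"
      using neumann_series(1)[OF A(1,2) z] by (simp add: is_op_inverse_def)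
    finally show ?thesis .
  qed
  have "((\<lambda>w. f w / (w - \<mu>)) has_contour_integral (2 * pi * \<i> * winding_number \<gamma> \<mu> * f \<mu>)) \<gamma>"
    using V \<gamma> wind(2) e(2)
    by (intro Cauchy_integral_formula_global[OF V(1,3)]) auto
  then have ci: "((\<lambda>t. f (\<gamma> t) / (\<gamma> t - \<mu>) * ?d t) has_integral (2 * pi * \<i> * f \<mu>)) {0..1}"
    using wind(1) e(2) by (simp add: has_contour_integral_def)
  have "blinfun_apply (op_contour_integral \<gamma> G) (c *\<^sub>C e) =
      integral {0..1} (\<lambda>t. blinfun_apply (scalar_op (?d t) o\<^sub>L G (\<gamma> t)) (c *\<^sub>C e))"
    unfolding op_contour_integral_def by (rule blinfun_apply_integral[OF int])
  also have "\<dots> = integral {0..1} (\<lambda>t. (f (\<gamma> t) / (\<gamma> t - \<mu>) * ?d t) *\<^sub>C (c *\<^sub>C e))"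
  proof (rule integral_cong)
    fix t :: real assume "t \<in> {0..1}"
    then have "\<gamma> t \<in> path_image \<gamma>" by (auto simp: path_image_def)
    then have "\<rho> < cmod (\<gamma> t)" using \<gamma>(3) by auto
    then show "blinfun_apply (scalar_op (?d t) o\<^sub>L G (\<gamma> t)) (c *\<^sub>C e) =
        (f (\<gamma> t) / (\<gamma> t - \<mu>) * ?d t) *\<^sub>C (c *\<^sub>C e)"
      by (simp add: G_def res scaleC_scaleC mult_ac)
  qed
  also have "\<dots> = (2 * pi * \<i> * f \<mu>) *\<^sub>C (c *\<^sub>C e)"
    using has_integral_linear[OF ci bounded_linear_scaleC_left[of "c *\<^sub>C e"]]
    by (intro integral_unique) (simp add: o_def)
  finally show ?thesis
    unfolding riesz_dunford_def
    by (simp add: \<gamma>_def[symmetric] G_def[abs_def] scaleC_scaleC mult_ac)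
qed

text \<open>
  The eigenvalue equation is needed on the whole complex line of \<open>e\<close>, since \<open>A\<close> may be only
  real-linear.
\<close>

lemma op_exp_eigenvector:
  fixes A :: "'a::complex_banach \<Rightarrow>\<^sub>L 'a"
  assumes e: "\<And>c. A (c *\<^sub>C e) = (c * \<mu>) *\<^sub>C e"
  shows "op_exp A (c *\<^sub>C e) = (c * exp \<mu>) *\<^sub>C e"
proof -
  have pow: "op_power A n (c *\<^sub>C e) = (c * \<mu> ^ n) *\<^sub>C e" for n
    by (induction n) (simp_all add: e mult_ac)
  have "summable (\<lambda>n. (1 / fact n) *\<^sub>R op_power A n)"
  proof (rule summable_comparison_test'[where N = 0])
    show "summable (\<lambda>n. inverse (fact n) * norm A ^ n)" by (rule summable_exp)
    show "norm ((1 / fact n) *\<^sub>R op_power A n) \<le> inverse (fact n) * norm A ^ n" for n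
      using norm_op_power_le[of A "norm A" n] by (simp add: divide_simps)
  qed
  then have "(\<lambda>n. (1 / fact n) *\<^sub>R op_power A n) sums op_exp A"
    unfolding op_exp_def by (rule summable_sums)
  then have "(\<lambda>n. blinfun_apply ((1 / fact n) *\<^sub>R op_power A n) (c *\<^sub>C e)) sums op_exp A (c *\<^sub>C e)"
    by (rule bounded_linear.sums[OF blinfun.bounded_linear_left])
  then have "(\<lambda>n. (\<mu> ^ n /\<^sub>R fact n) *\<^sub>C (c *\<^sub>C e)) sums op_exp A (c *\<^sub>C e)"
    by (simp add: blinfun.scaleR_left pow scaleR_eq_scaleC scaleC_scaleC scaleR_conv_of_real divide_simps mult_ac)
  moreover have "(\<lambda>n. (\<mu> ^ n /\<^sub>R fact n) *\<^sub>C (c *\<^sub>C e)) sums (exp \<mu> *\<^sub>C (c *\<^sub>C e))"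
    by (rule bounded_linear.sums[OF bounded_linear_scaleC_left exp_converges])
  ultimately show ?thesis
    using sums_unique2 by (fastforce simp: scaleC_scaleC mult.commute)
qed

section \<open>The spectrum of the derivative\<close>

lemma herzog_deriv_linear: "\<rho> > 0 \<Longrightarrow> complex_linear_op (herzog_deriv \<rho>)"
  unfolding complex_linear_op_def
  by (auto intro!: c0_eqI simp: herzog_deriv_apply(2))

lemma norm_herzog_deriv_le:
  assumes "\<rho> > 0"
  shows "norm (herzog_deriv \<rho>) \<le> \<rho>"
proof (rule norm_blinfun_bound)
  show "norm (herzog_deriv \<rho> a) \<le> \<rho> * norm a" for a
    using assms norm_Rep_c0_le[of a]
    by (intro norm_c0_leI) (simp add: herzog_deriv_apply(2) norm_mult)
qed (use assms in simp)

lemma herzog_deriv_geo: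
  assumes "\<rho> > 0" "cmod w < 1"
  shows "herzog_deriv \<rho> (geo w) = (of_real \<rho> * w) *\<^sub>C geo w"
  using assms by (intro c0_eqI) (simp add: herzog_deriv_apply(2) Rep_geo_coeff)

text \<open>
  The equation makes the moduli of the entries of \<open>x\<close> increase; they tend to 0 only if all vanish.
  On the circle \<open>\<bar>z\<bar> = \<rho>\<close> this is the decisive difference from the points inside.
\<close>

lemma herzog_deriv_no_eigenvector:
  assumes \<rho>: "\<rho> > 0" and z: "\<rho> \<le> cmod z" and x: "herzog_deriv \<rho> x = z *\<^sub>C x"
  shows "x = 0"
proof (rule c0_eqI)
  fix n
  have step: "cmod (Rep_c0 x k) \<le> cmod (Rep_c0 x (Suc k))" for k
  proof -
    have "\<rho> * cmod (Rep_c0 x (Suc k)) = cmod z * cmod (Rep_c0 x k)"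
      using arg_cong[OF x, of "\<lambda>a. cmod (Rep_c0 a k)"] \<rho>
      by (simp add: herzog_deriv_apply(2) norm_mult)
    moreover have "\<rho> * cmod (Rep_c0 x k) \<le> cmod z * cmod (Rep_c0 x k)"
      using z by (intro mult_right_mono) auto
    ultimately show ?thesis using \<rho> by (metis mult_le_cancel_left_pos)
  qed
  have "(\<lambda>k. cmod (Rep_c0 x k)) \<longlonglongrightarrow> 0"
    using Rep_c0_tendsto tendsto_norm_zero by blast
  then have "cmod (Rep_c0 x n) \<le> 0"
    using incseq_le[of "\<lambda>k. cmod (Rep_c0 x k)" 0 n] step by (simp add: incseq_Suc_iff)
  then show "Rep_c0 x n = Rep_c0 0 n" by simp
qed

text \<open>
  Every \<open>z\<close> of the closed disc, including its boundary, is an approximate eigenvalue: along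
  points \<open>w\<^sub>n\<close> of the open unit disc with limit \<open>z / \<rho>\<close>, the unit vectors \<open>geo w\<^sub>n\<close> are mapped by
  \<open>z - A\<close> to vectors of norm \<open>\<bar>z - \<rho> w\<^sub>n\<bar>\<close>, which tends to 0.
\<close>

lemma op_spectrum_herzog_deriv:
  assumes \<rho>: "\<rho> > 0"
  shows "op_spectrum (herzog_deriv \<rho>) = cball 0 \<rho>"
proof (intro equalityI subsetI)
  fix z assume "z \<in> op_spectrum (herzog_deriv \<rho>)"
  then show "z \<in> cball 0 \<rho>"
    using neumann_series(1)[OF herzog_deriv_linear[OF \<rho>] norm_herzog_deriv_le[OF \<rho>], of z]
    by (force simp: op_spectrum_def)
next
  fix z :: complex assume z: "z \<in> cball 0 \<rho>"
  show "z \<in> op_spectrum (herzog_deriv \<rho>)"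
    unfolding op_spectrum_def
  proof (intro CollectI notI)
    assume "\<exists>B. is_op_inverse (scalar_op z - herzog_deriv \<rho>) B"
    then obtain B where B: "B o\<^sub>L (scalar_op z - herzog_deriv \<rho>) = id_blinfun"
      by (auto simp: is_op_inverse_def)
    \<comment> \<open>\<open>z / \<rho>\<close> itself may lie on the unit circle; the points \<open>w n\<close> approach it radially from inside.\<close>
    define w where "w n = of_real (1 - 1 / real (Suc n)) * (z / of_real \<rho>)" for n
    have w: "cmod (w n) < 1" for n
    proof -
      have "cmod (w n) = (1 - 1 / real (Suc n)) * (cmod z / \<rho>)"
        using \<rho> by (simp add: w_def norm_mult norm_divide del: of_real_diff)
      also have "\<dots> \<le> (1 - 1 / real (Suc n)) * 1"
        using z \<rho> by (intro mult_left_mono) (auto simp: divide_le_eq_1)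
      also have "\<dots> < 1" by (simp del: of_nat_Suc)
      finally show ?thesis .
    qed
    have "1 \<le> norm B * (cmod z * inverse (real (Suc n)))" for n
    proof -
      have "geo (w n) = B ((scalar_op z - herzog_deriv \<rho>) (geo (w n)))"
        using arg_cong[OF B, of "\<lambda>T. T (geo (w n))"] by simp
      also have "(scalar_op z - herzog_deriv \<rho>) (geo (w n)) = (z - of_real \<rho> * w n) *\<^sub>C geo (w n)"
        using w[of n] \<rho> by (simp add: blinfun.diff_left herzog_deriv_geo scaleC_diff_left)
      also have "z - of_real \<rho> * w n = z * of_real (inverse (real (Suc n)))"
      proof -
        have "of_real \<rho> * w n = of_real (1 - inverse (real (Suc n))) * z"
          using \<rho> by (simp add: w_def inverse_eq_divide del: of_nat_Suc of_real_diff)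
        also have "\<dots> = z - z * of_real (inverse (real (Suc n)))"
          by (simp only: of_real_diff of_real_1 left_diff_distrib mult_1_left mult.commute[of z])
        finally show ?thesis by simp
      qed
      finally have "norm (geo (w n)) \<le>
          norm B * norm ((z * of_real (inverse (real (Suc n)))) *\<^sub>C geo (w n))"
        by (metis norm_blinfun)
      also have "norm ((z * of_real (inverse (real (Suc n)))) *\<^sub>C geo (w n)) =
          cmod z * inverse (real (Suc n))"
        using w[of n] by (simp only: norm_scaleC norm_geo norm_mult norm_of_real) simp
      finally show ?thesis using w[of n] by (simp add: norm_geo)
    qed
    moreover have "(\<lambda>n. norm B * (cmod z * inverse (real (Suc n)))) \<longlonglongrightarrow> norm B * (cmod z * 0)"
      by (intro tendsto_intros LIMSEQ_inverse_real_of_nat)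
    ultimately have "1 \<le> norm B * (cmod z * 0)"
      by (intro LIMSEQ_le_const) auto
    then show False by simp
  qed
qed

section \<open>Symbols\<close>

text \<open>
  The scalar \<open>c\<close> is part of the condition because a real-linear operator is not determined by its
  values at the vectors \<open>geo w\<close>: for example, their first entry is always real.
\<close>

definition has_symbol :: "real \<Rightarrow> (c0 \<Rightarrow>\<^sub>L c0) \<Rightarrow> (complex \<Rightarrow> complex) \<Rightarrow> bool" where
  "has_symbol \<rho> T h \<longleftrightarrow>
     (\<forall>c w. cmod w < 1 \<longrightarrow> T (c *\<^sub>C geo w) = (c * h (of_real \<rho> * w)) *\<^sub>C geo w)"

lemma has_symbol_unique:
  assumes "has_symbol \<rho> S h" "has_symbol \<rho> T h"
  shows "S = T"
proof -
  define Y where "Y = {x. \<forall>c. S (c *\<^sub>C x) = T (c *\<^sub>C x)}"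
  have "complex_subspace Y"
    by (auto simp: complex_subspace_def Y_def scaleC_add_right scaleC_scaleC blinfun.add_right)
  moreover have "closed Y"
  proof -
    have "Y = (\<Inter>c. {x. S (c *\<^sub>C x) = T (c *\<^sub>C x)})" by (auto simp: Y_def)
    moreover have "closed {x. S (c *\<^sub>C x) = T (c *\<^sub>C x)}" for c
      by (intro closed_Collect_eq continuous_intros
          bounded_linear.continuous_on[OF bounded_linear_scaleC])
    ultimately show ?thesis by auto
  qed
  moreover have "(0::complex) islimpt ball 0 1"
    by (simp add: interior_limit_point)
  moreover have "geo v \<in> Y" if "v \<in> ball 0 1" for v
    using assms that by (auto simp: has_symbol_def Y_def)
  ultimately have "Y = UNIV"
    by (intro geo_total[of Y "ball 0 1" 0]) auto
  then have "S (1 *\<^sub>C x) = T (1 *\<^sub>C x)" for x unfolding Y_def by blast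
  then show ?thesis by (intro blinfun_eqI) simp
qed

lemma has_symbol_id: "has_symbol \<rho> id_blinfun (\<lambda>_. 1)"
  by (simp add: has_symbol_def)

lemma has_symbol_scalar_op: "has_symbol \<rho> (scalar_op c) (\<lambda>_. c)"
  by (simp add: has_symbol_def scaleC_scaleC mult.commute)

lemma has_symbol_compose:
  "has_symbol \<rho> S g \<Longrightarrow> has_symbol \<rho> T h \<Longrightarrow> has_symbol \<rho> (S o\<^sub>L T) (\<lambda>z. g z * h z)"
  by (simp add: has_symbol_def mult_ac)

lemma has_symbol_diff:
  "has_symbol \<rho> S g \<Longrightarrow> has_symbol \<rho> T h \<Longrightarrow> has_symbol \<rho> (S - T) (\<lambda>z. g z - h z)"
  by (simp add: has_symbol_def blinfun.diff_left scaleC_diff_left right_diff_distrib)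

lemma has_symbol_cong:
  assumes "has_symbol \<rho> T g" "\<rho> > 0" "\<And>z. z \<in> ball 0 \<rho> \<Longrightarrow> g z = h z"
  shows "has_symbol \<rho> T h"
proof -
  have "g (of_real \<rho> * w) = h (of_real \<rho> * w)" if "cmod w < 1" for w
    using that assms(2) by (intro assms(3)) (simp add: norm_mult)
  then show ?thesis using assms(1) by (simp add: has_symbol_def)
qed

text \<open>
  \<open>T\<close> composed with multiplication by \<open>c\<close> has the symbol \<open>c h\<close>, on either side.
\<close>

lemma has_symbol_complex_linear:
  assumes "has_symbol \<rho> T h"
  shows "T (c *\<^sub>C x) = c *\<^sub>C T x"
proof -
  have "has_symbol \<rho> (T o\<^sub>L scalar_op c) (\<lambda>z. h z * c)"
    by (rule has_symbol_compose[OF assms has_symbol_scalar_op])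
  moreover have "has_symbol \<rho> (scalar_op c o\<^sub>L T) (\<lambda>z. h z * c)"
    using has_symbol_compose[OF has_symbol_scalar_op assms, of c] by (simp add: mult.commute)
  ultimately have "T o\<^sub>L scalar_op c = scalar_op c o\<^sub>L T" by (rule has_symbol_unique)
  from arg_cong[OF this, of "\<lambda>S. S x"] show ?thesis by simp
qed

lemma has_symbol_herzog_deriv:
  assumes "\<rho> > 0"
  shows "has_symbol \<rho> (herzog_deriv \<rho>) (\<lambda>z. z)"
  using herzog_deriv_linear[OF assms] herzog_deriv_geo[OF assms]
  by (simp add: has_symbol_def complex_linear_op_def scaleC_scaleC)

lemma has_symbol_riesz_dunford:
  assumes "\<rho> > 0" "f holomorphic_on U" "open U" "cball 0 \<rho> \<subseteq> U"
  shows "has_symbol \<rho> (riesz_dunford f (herzog_deriv \<rho>)) f"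
  unfolding has_symbol_def
proof (intro allI impI)
  fix c w assume w: "cmod w < 1"
  then have "cmod (of_real \<rho> * w) \<le> \<rho>"
    using assms(1) by (simp add: norm_mult mult_left_le)
  then show "riesz_dunford f (herzog_deriv \<rho>) (c *\<^sub>C geo w) = (c * f (of_real \<rho> * w)) *\<^sub>C geo w"
    using herzog_deriv_geo[OF assms(1) w]
    by (intro riesz_dunford_eigenvector[OF herzog_deriv_linear norm_herzog_deriv_le
        op_spectrum_herzog_deriv _ assms(2-4)] assms(1))
qed

lemma has_symbol_op_exp:
  assumes "has_symbol \<rho> F f"
  shows "has_symbol \<rho> (op_exp (t *\<^sub>R F)) (\<lambda>z. exp (of_real t * f z))"
  unfolding has_symbol_def
proof (intro allI impI)
  fix c w assume w: "cmod w < 1"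
  show "op_exp (t *\<^sub>R F) (c *\<^sub>C geo w) = (c * exp (of_real t * f (of_real \<rho> * w))) *\<^sub>C geo w"
  proof (rule op_exp_eigenvector)
    show "(t *\<^sub>R F) (c *\<^sub>C geo w) = (c * (of_real t * f (of_real \<rho> * w))) *\<^sub>C geo w" for c
      using assms w
      by (simp add: has_symbol_def blinfun.scaleR_left scaleR_eq_scaleC scaleC_scaleC mult_ac)
  qed
qed

section \<open>Injectivity of operators whose symbol has no zero in the open disc\<close>

text \<open>
  The operator with symbol \<open>1 / h\<close> is a left inverse.
\<close>

lemma has_symbol_injective_nonvanishing:
  assumes \<rho>: "\<rho> > 0" and h: "h holomorphic_on U" "open U" "cball 0 \<rho> \<subseteq> U"
    and nz: "\<And>z. z \<in> cball 0 \<rho> \<Longrightarrow> h z \<noteq> 0"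
    and T: "has_symbol \<rho> T h" "T x = 0"
  shows "x = 0"
proof -
  define V where "V = {z \<in> U. h z \<noteq> 0}"
  have "open V"
  proof -
    have "V = U \<inter> h -` (- {0})" by (auto simp: V_def)
    then show ?thesis
      using continuous_open_preimage[OF holomorphic_on_imp_continuous_on[OF h(1)] h(2), of "- {0}"]
      by (simp add: open_Compl)
  qed
  moreover have "(\<lambda>z. 1 / h z) holomorphic_on V"
    by (intro holomorphic_intros holomorphic_on_subset[OF h(1)]) (auto simp: V_def)
  moreover have "cball 0 \<rho> \<subseteq> V" using h(3) nz by (auto simp: V_def)
  ultimately have S: "has_symbol \<rho> (riesz_dunford (\<lambda>z. 1 / h z) (herzog_deriv \<rho>)) (\<lambda>z. 1 / h z)"
    using has_symbol_riesz_dunford[OF \<rho>] by blast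
  have "has_symbol \<rho> (riesz_dunford (\<lambda>z. 1 / h z) (herzog_deriv \<rho>) o\<^sub>L T) (\<lambda>_. 1)"
    using has_symbol_cong[OF has_symbol_compose[OF S T(1)] \<rho>, of "\<lambda>_. 1"] nz by simp
  then have "riesz_dunford (\<lambda>z. 1 / h z) (herzog_deriv \<rho>) o\<^sub>L T = id_blinfun"
    by (rule has_symbol_unique[OF _ has_symbol_id])
  from arg_cong[OF this, of "\<lambda>S. S x"] show "x = 0" using T(2) by simp
qed

lemma divide_out_zero:
  assumes h: "h holomorphic_on S" "open S" "connected S" "\<xi> \<in> S" "h \<xi> = 0" "\<not> h constant_on S"
  obtains g n where "g holomorphic_on S" "g \<xi> \<noteq> 0" "\<And>z. z \<in> S \<Longrightarrow> h z = (z - \<xi>) ^ n * g z"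
proof -
  obtain g r n where g: "0 < n" "0 < r" "ball \<xi> r \<subseteq> S" "g holomorphic_on ball \<xi> r"
    "\<And>w. w \<in> ball \<xi> r \<Longrightarrow> h w = (w - \<xi>) ^ n * g w"
    "\<And>w. w \<in> ball \<xi> r \<Longrightarrow> g w \<noteq> 0"
    using holomorphic_factor_zero_nonconstant[OF h] by metis
  define G where "G z = (if z = \<xi> then g \<xi> else h z / (z - \<xi>) ^ n)" for z
  have "G holomorphic_on ball \<xi> r"
    using g(4) by (rule holomorphic_transform) (auto simp: G_def g(5))
  moreover have "G holomorphic_on S - {\<xi>}"
  proof (rule holomorphic_transform)
    show "(\<lambda>z. h z / (z - \<xi>) ^ n) holomorphic_on S - {\<xi>}"
      by (intro holomorphic_intros holomorphic_on_subset[OF h(1)]) auto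
  qed (auto simp: G_def)
  ultimately have "G holomorphic_on ball \<xi> r \<union> (S - {\<xi>})"
    using h(2) by (intro holomorphic_on_Un) (auto intro: open_delete)
  moreover have "ball \<xi> r \<union> (S - {\<xi>}) = S"
    using g(2,3) h(4) by auto
  ultimately have "G holomorphic_on S" by simp
  moreover have "G \<xi> \<noteq> 0" using g(2) g(6)[of \<xi>] by (simp add: G_def)
  moreover have "h z = (z - \<xi>) ^ n * G z" if "z \<in> S" for z
    using g(1) h(5) by (auto simp: G_def)
  ultimately show ?thesis using that by blast
qed

text \<open>
  Induction on the number of zeros of \<open>h\<close> in the closed disc. They all lie on the circle
  \<open>\<bar>\<xi>\<bar> = \<rho>\<close>, and dividing out one of them, with its full multiplicity, splits off a power of
  \<open>A - \<xi>\<close>, which is injective.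
\<close>

theorem has_symbol_injective:
  assumes \<rho>: "\<rho> > 0" "\<rho> < R" and h: "h holomorphic_on ball 0 R"
    and nz: "\<And>z. z \<in> ball 0 \<rho> \<Longrightarrow> h z \<noteq> 0"
    and T: "has_symbol \<rho> T h" "T x = 0"
  shows "x = 0"
  using h nz T
proof (induction "card {z \<in> cball 0 \<rho>. h z = 0}" arbitrary: h T x rule: less_induct)
  case less
  note h = less.prems(1) and nz = less.prems(2)
  have sub: "cball 0 \<rho> \<subseteq> ball (0::complex) R" using \<rho> by auto
  show ?case
  proof (cases "\<exists>\<xi>\<in>cball 0 \<rho>. h \<xi> = 0")
    case False
    then show ?thesis
      using has_symbol_injective_nonvanishing[OF \<rho>(1) h open_ball sub _ less.prems(3,4)] by blast
  next
    case True
    then obtain \<xi> where \<xi>: "\<xi> \<in> cball 0 \<rho>" "h \<xi> = 0" by blast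
    have nc: "\<not> h constant_on ball 0 R"
      using nz[of 0] \<xi> \<rho> sub unfolding constant_on_def
      by (metis centre_in_ball less_trans subsetD)
    have fin: "finite {z \<in> cball 0 \<rho>. h z = 0}"
      using holomorphic_compact_finite_zeros[OF h open_ball _ compact_cball sub nc] by simp
    obtain g n where g: "g holomorphic_on ball 0 R" "g \<xi> \<noteq> 0"
      "\<And>z. z \<in> ball 0 R \<Longrightarrow> h z = (z - \<xi>) ^ n * g z"
      using divide_out_zero[OF h open_ball _ _ \<xi>(2) nc] \<xi>(1) sub by (metis connected_ball subsetD)
    define G where "G = riesz_dunford g (herzog_deriv \<rho>)"
    have G: "has_symbol \<rho> G g"
      unfolding G_def by (rule has_symbol_riesz_dunford[OF \<rho>(1) g(1) open_ball sub])
    define D where "D = herzog_deriv \<rho> - scalar_op \<xi>"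
    have D: "has_symbol \<rho> D (\<lambda>z. z - \<xi>)"
      unfolding D_def by (intro has_symbol_diff has_symbol_herzog_deriv has_symbol_scalar_op \<rho>)
    have pow: "has_symbol \<rho> (op_power D k o\<^sub>L G) (\<lambda>z. (z - \<xi>) ^ k * g z)" for k
    proof (induction k)
      case 0
      show ?case using has_symbol_compose[OF has_symbol_id G] by simp
    next
      case (Suc k)
      have "op_power D (Suc k) o\<^sub>L G = D o\<^sub>L (op_power D k o\<^sub>L G)"
        by (rule blinfun_eqI) simp
      then show ?case using has_symbol_compose[OF D Suc] by (simp add: mult.assoc)
    qed
    have "T = op_power D n o\<^sub>L G"
    proof (rule has_symbol_unique[OF less.prems(3)])
      show "has_symbol \<rho> (op_power D n o\<^sub>L G) h"
        using has_symbol_cong[OF pow[of n] \<rho>(1), of h] g(3) \<rho>(2) by auto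
    qed
    then have "op_power D n (G x) = 0" using less.prems(4) by simp
    moreover have "y = 0" if "op_power D k y = 0" for k y
      using that
    proof (induction k)
      case (Suc k)
      have "\<rho> \<le> cmod \<xi>" using nz[of \<xi>] \<xi>(2) by (auto simp: not_less[symmetric])
      moreover have "herzog_deriv \<rho> (op_power D k y) = \<xi> *\<^sub>C op_power D k y"
        using Suc.prems by (simp add: D_def blinfun.diff_left)
      ultimately show ?case using herzog_deriv_no_eigenvector[OF \<rho>(1)] Suc.IH by blast
    qed simp
    ultimately have "G x = 0" by blast
    moreover have "{z \<in> cball 0 \<rho>. g z = 0} \<subset> {z \<in> cball 0 \<rho>. h z = 0}"
      using g(2,3) \<xi> sub by auto
    then have "card {z \<in> cball 0 \<rho>. g z = 0} < card {z \<in> cball 0 \<rho>. h z = 0}"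
      using fin by (rule psubset_card_mono[rotated])
    moreover have "g z \<noteq> 0" if "z \<in> ball 0 \<rho>" for z
      using nz[OF that] g(3)[of z] that \<rho>(2) by auto
    ultimately show ?thesis using less.hyps g(1) G by blast
  qed
qed

section \<open>Periodic points\<close>

text \<open>
  The lemmas about a family \<open>T\<close> of operators with symbols \<open>exp (t f)\<close> also concern negative
  \<open>t\<close>: the backward orbits of the group are needed for the density of an orbit.
\<close>

lemma exp_symbol_add:
  assumes T: "\<And>t. has_symbol \<rho> (T t) (\<lambda>z. exp (of_real t * f z))"
  shows "T (s + t) x = T s (T t x)"
proof -
  have "has_symbol \<rho> (T s o\<^sub>L T t) (\<lambda>z. exp (of_real (s + t) * f z))"
    using has_symbol_compose[OF T T, of s t] by (simp add: distrib_right exp_add)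
  then have "T (s + t) = T s o\<^sub>L T t" by (rule has_symbol_unique[OF T])
  then show ?thesis by simp
qed

lemma exp_symbol_0:
  assumes T: "\<And>t. has_symbol \<rho> (T t) (\<lambda>z. exp (of_real t * f z))"
  shows "T 0 x = x"
  using has_symbol_unique[OF _ has_symbol_id, of \<rho> "T 0"] T[of 0] by simp

text \<open>
  A periodic point \<open>x\<close> lies in the kernel of \<open>T t - I\<close>, whose symbol \<open>exp (t f) - 1\<close> vanishes
  only where \<open>f\<close> is imaginary.
\<close>

lemma periodic_points_dense_imp:
  assumes \<rho>: "\<rho> > 0" "\<rho> < R" and f: "f holomorphic_on ball 0 R"
    and T: "\<And>t. has_symbol \<rho> (T t) (\<lambda>z. exp (of_real t * f z))"
    and dense: "closure {x. \<exists>t>0. T t x = x} = UNIV"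
  shows "\<exists>z\<in>ball 0 \<rho>. Re (f z) = 0"
proof (rule ccontr)
  assume neg: "\<not> (\<exists>z\<in>ball 0 \<rho>. Re (f z) = 0)"
  have "x = 0" if t: "t > 0" "T t x = x" for t x
  proof (rule has_symbol_injective[OF \<rho>])
    show "(\<lambda>z. exp (of_real t * f z) - 1) holomorphic_on ball 0 R"
      by (intro holomorphic_intros f)
    show "has_symbol \<rho> (T t - id_blinfun) (\<lambda>z. exp (of_real t * f z) - 1)"
      by (rule has_symbol_diff[OF T has_symbol_id])
    show "(T t - id_blinfun) x = 0" using t by (simp add: blinfun.diff_left)
    show "exp (of_real t * f z) - 1 \<noteq> 0" if "z \<in> ball 0 \<rho>" for z
    proof
      assume "exp (of_real t * f z) - 1 = 0"
      then have "norm (exp (of_real t * f z)) = 1" by simp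
      then have "t * Re (f z) = 0" by (simp add: norm_exp_eq_Re)
      then show False using neg t(1) that by auto
    qed
  qed
  then have "{x. \<exists>t>0. T t x = x} \<subseteq> {0}" by blast
  then have "closure {x. \<exists>t>0. T t x = x} \<subseteq> {0}" by (rule closure_minimal) simp
  then have "geo 0 = 0" using dense by auto
  then show False using norm_geo[of 0] by simp
qed

text \<open>
  By the open mapping theorem, values of \<open>g\<close> in \<open>V\<close> that are close to \<open>g w\<close> but different from
  it are attained close to \<open>w\<close>, necessarily at points different from \<open>w\<close>.
\<close>

lemma islimpt_preimage:
  assumes g: "g holomorphic_on S" "open S" "connected S" "\<not> g constant_on S"
    and w: "w \<in> S" and lim: "g w islimpt V"
  shows "w islimpt {z \<in> S. g z \<in> V}"
  unfolding islimpt_approachable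
proof (intro allI impI)
  fix e :: real assume e: "e > 0"
  have "open (g ` (S \<inter> ball w e))"
    using g by (intro open_mapping_thm[OF g(1-3)]) auto
  moreover have "g w \<in> g ` (S \<inter> ball w e)" using w e by auto
  ultimately obtain v where "v \<in> V" "v \<in> g ` (S \<inter> ball w e)" "v \<noteq> g w"
    using lim unfolding islimpt_def by metis
  then show "\<exists>z\<in>{z \<in> S. g z \<in> V}. z \<noteq> w \<and> dist z w < e"
    by (auto simp: dist_commute)
qed

text \<open>
  The set contains all rational multiples of \<open>2 \<pi> \<i>\<close>.
\<close>

lemma islimpt_root_of_unity_exponents:
  assumes "Re v = 0"
  shows "v islimpt {u. \<exists>n>0. exp (of_nat n * u) = 1}"
  unfolding islimpt_approachable
proof (intro allI impI)
  fix e :: real assume e: "e > 0"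
  obtain r where r: "r \<in> \<rat>" "Im v / (2 * pi) < r" "r < (Im v + e) / (2 * pi)"
    using Rats_dense_in_real[of "Im v / (2 * pi)" "(Im v + e) / (2 * pi)"] e
    by (auto simp: divide_strict_right_mono)
  obtain i n where i: "r = of_int i / of_nat n" "n \<noteq> 0"
    using r(1) unfolding Rats_eq_int_div_nat by blast
  define u where "u = Complex 0 (2 * pi * r)"
  have "of_nat n * u = (2 * of_int i * pi) * \<i>"
    using i by (auto simp: u_def complex_eq_iff)
  then have "exp (of_nat n * u) = 1"
    using exp_integer_2pi[of "of_int i"] by simp
  moreover have b: "Im v < 2 * pi * r" "2 * pi * r < Im v + e"
    using r(2,3) by (simp_all add: pos_divide_less_eq pos_less_divide_eq mult_ac)
  then have "u \<noteq> v" by (auto simp: u_def)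
  moreover have "u - v = \<i> * of_real (2 * pi * r - Im v)"
    using assms by (simp add: u_def complex_eq_iff)
  then have "dist u v = \<bar>2 * pi * r - Im v\<bar>"
    by (simp only: dist_norm norm_mult norm_ii norm_of_real mult_1_left)
  then have "dist u v < e" using b by simp
  ultimately show "\<exists>u\<in>{u. \<exists>n>0. exp (of_nat n * u) = 1}. u \<noteq> v \<and> dist u v < e"
    using i(2) by auto
qed

lemma islimpt_half_plane:
  assumes "Re v = 0" "s \<noteq> 0"
  shows "v islimpt {u. s * Re u < 0}"
  unfolding islimpt_approachable
proof (intro allI impI)
  fix e :: real assume e: "e > 0"
  define u where "u = v - of_real (sgn s * (e / 2))"
  have "s * Re u = - (\<bar>s\<bar> * (e / 2))"
    using assms by (simp add: u_def abs_sgn[of s])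
  also have "\<dots> < 0" using assms(2) e by simp
  finally have "s * Re u < 0" .
  moreover have "dist u v = e / 2"
    using assms(2) e by (simp add: u_def dist_norm norm_mult abs_mult sgn_if)
  then have "dist u v < e" "u \<noteq> v" using e by auto
  ultimately show "\<exists>u\<in>{u. s * Re u < 0}. u \<noteq> v \<and> dist u v < e" by blast
qed

text \<open>
  The common source of the three density statements: \<open>V\<close> is the set of exponents for which the
  eigenvectors have the wanted orbits, and \<open>Y\<close> is the space of all vectors with such orbits.
\<close>

lemma geo_total_preimage:
  assumes \<rho>: "\<rho> > 0" and f: "f holomorphic_on ball 0 \<rho>" "\<not> f constant_on ball 0 \<rho>"
    and z: "z \<in> ball 0 \<rho>" "f z islimpt V"
    and Y: "complex_subspace Y" "\<And>w. cmod w < 1 \<Longrightarrow> f (of_real \<rho> * w) \<in> V \<Longrightarrow> geo w \<in> Y"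
  shows "closure Y = UNIV"
proof -
  let ?g = "\<lambda>w. f (of_real \<rho> * w)"
  let ?w = "z / of_real \<rho>"
  have scale: "of_real \<rho> * w \<in> ball 0 \<rho> \<longleftrightarrow> cmod w < 1" for w
    using \<rho> by (simp add: norm_mult)
  have "?g holomorphic_on ball 0 1"
  proof -
    have "(\<lambda>w::complex. of_real \<rho> * w) holomorphic_on ball 0 1" by (intro holomorphic_intros)
    moreover have "(\<lambda>w::complex. of_real \<rho> * w) ` ball 0 1 \<subseteq> ball 0 \<rho>"
      using scale by (intro image_subsetI) simp
    ultimately show ?thesis
      using holomorphic_on_compose_gen[OF _ f(1)] by (simp add: o_def)
  qed
  moreover have "\<not> ?g constant_on ball 0 1"
  proof
    assume "?g constant_on ball 0 1"
    then obtain c where c: "\<And>w. cmod w < 1 \<Longrightarrow> ?g w = c" by (auto simp: constant_on_def)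
    have "f x = c" if "x \<in> ball 0 \<rho>" for x
      using c[of "x / of_real \<rho>"] that \<rho> by (simp add: norm_divide divide_less_eq_1)
    then show False using f(2) by (auto simp: constant_on_def)
  qed
  moreover have w: "?w \<in> ball 0 1" "?g ?w = f z"
    using z(1) \<rho> by (auto simp: norm_divide divide_less_eq_1)
  ultimately have "?w islimpt {w \<in> ball 0 1. ?g w \<in> V}"
    using z(2) by (intro islimpt_preimage) auto
  then show ?thesis
    using Y w closure_subset[of Y]
    by (intro geo_total[OF complex_subspace_closure[OF Y(1)] closed_closure, of "{w \<in> ball 0 1. ?g w \<in> V}" ?w])
      auto
qed

lemma exp_symbol_geo:
  assumes "has_symbol \<rho> (T t) (\<lambda>z. exp (of_real t * f z))" "cmod w < 1"
  shows "T t (geo w) = exp (of_real t * f (of_real \<rho> * w)) *\<^sub>C geo w"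
  using assms unfolding has_symbol_def by (metis mult_1 scaleC_one)

text \<open>
  Integer periods suffice, and with them the periodic points form a subspace: \<open>n m\<close> is a common
  period of a point of period \<open>n\<close> and a point of period \<open>m\<close>.
\<close>

lemma periodic_points_dense:
  assumes \<rho>: "\<rho> > 0" and f: "f holomorphic_on ball 0 \<rho>" "\<not> f constant_on ball 0 \<rho>"
    and T: "\<And>t. has_symbol \<rho> (T t) (\<lambda>z. exp (of_real t * f z))"
    and z: "z \<in> ball 0 \<rho>" "Re (f z) = 0"
  shows "closure {x. \<exists>t>0. T t x = x} = UNIV"
proof -
  define P where "P = {x. \<exists>n>0. T (real n) x = x}"
  have mult: "T (real (n * m)) x = x" if "T (real n) x = x" for n m x
  proof (induction m)
    case 0
    show ?case by (simp add: exp_symbol_0[OF T])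
  next
    case (Suc m)
    have "T (real (n * Suc m)) x = T (real n) (T (real (n * m)) x)"
      using exp_symbol_add[OF T, of "real n" "real (n * m)" x] by simp
    then show ?case using Suc that by simp
  qed
  have "complex_subspace P"
    unfolding complex_subspace_def
  proof (intro conjI ballI allI)
    show "0 \<in> P" by (auto simp: P_def)
  next
    fix x y assume "x \<in> P" "y \<in> P"
    then obtain n m where nm: "n > 0" "T (real n) x = x" "m > 0" "T (real m) y = y"
      by (auto simp: P_def)
    have "T (real (n * m)) (x + y) = x + y"
      using mult[OF nm(2), of m] mult[OF nm(4), of n]
      by (simp add: blinfun.add_right mult.commute)
    then show "x + y \<in> P" using nm unfolding P_def by (intro CollectI exI[of _ "n * m"]) auto
  next
    fix c x assume "x \<in> P"
    then show "c *\<^sub>C x \<in> P"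
      using has_symbol_complex_linear[OF T] by (auto simp: P_def)
  qed
  moreover have "geo w \<in> P"
    if "cmod w < 1" "f (of_real \<rho> * w) \<in> {u. \<exists>n>0. exp (of_nat n * u) = 1}" for w
  proof -
    from that(2) obtain n :: nat where "n > 0" "exp (of_nat n * f (of_real \<rho> * w)) = 1" by blast
    then show ?thesis
      using exp_symbol_geo[where T = T, OF T that(1), of "real n"] unfolding P_def by auto
  qed
  ultimately have "closure P = UNIV"
    using geo_total_preimage[OF \<rho> f z(1) islimpt_root_of_unity_exponents[OF z(2)], of P] by blast
  moreover have "P \<subseteq> {x. \<exists>t>0. T t x = x}"
    unfolding P_def using of_nat_0_less_iff by blast
  ultimately show ?thesis using closure_mono by blast
qed

section \<open>Dense orbits\<close>

text \<open>
  Used with \<open>s = 1\<close> for forward orbits and with \<open>s = - 1\<close> for backward orbits.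
\<close>

lemma decaying_orbits_dense:
  assumes \<rho>: "\<rho> > 0" and f: "f holomorphic_on ball 0 \<rho>" "\<not> f constant_on ball 0 \<rho>"
    and T: "\<And>t. has_symbol \<rho> (T t) (\<lambda>z. exp (of_real t * f z))"
    and z: "z \<in> ball 0 \<rho>" "Re (f z) = 0" and s: "s \<noteq> 0"
  shows "closure {x. (\<lambda>n. T (s * real n) x) \<longlonglongrightarrow> 0} = UNIV"
proof (rule geo_total_preimage[OF \<rho> f z(1) islimpt_half_plane[OF z(2) s]])
  show "complex_subspace {x. (\<lambda>n. T (s * real n) x) \<longlonglongrightarrow> 0}"
    unfolding complex_subspace_def
  proof (intro conjI ballI allI)
    fix x y
    assume "x \<in> {x. (\<lambda>n. T (s * real n) x) \<longlonglongrightarrow> 0}" "y \<in> {x. (\<lambda>n. T (s * real n) x) \<longlonglongrightarrow> 0}"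
    then show "x + y \<in> {x. (\<lambda>n. T (s * real n) x) \<longlonglongrightarrow> 0}"
      using tendsto_add[of "\<lambda>n. T (s * real n) x" 0 sequentially "\<lambda>n. T (s * real n) y" 0]
      by (simp add: blinfun.add_right)
  next
    fix c x assume "x \<in> {x. (\<lambda>n. T (s * real n) x) \<longlonglongrightarrow> 0}"
    then show "c *\<^sub>C x \<in> {x. (\<lambda>n. T (s * real n) x) \<longlonglongrightarrow> 0}"
      using bounded_linear.tendsto[OF bounded_linear_scaleC, of "\<lambda>n. T (s * real n) x" 0 sequentially c]
      by (simp add: has_symbol_complex_linear[OF T])
  qed simp
  fix w assume w: "cmod w < 1" "f (of_real \<rho> * w) \<in> {u. s * Re u < 0}"
  define a where "a = exp (of_real s * f (of_real \<rho> * w))"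
  have a: "cmod a < 1" using w(2) by (simp add: a_def)
  have "T (s * real n) (geo w) = a ^ n *\<^sub>C geo w" for n
    using exp_symbol_geo[where T = T, OF T w(1), of "s * real n"]
    by (simp add: a_def mult_ac flip: exp_of_nat_mult)
  moreover have "(\<lambda>n. a ^ n *\<^sub>C geo w) \<longlonglongrightarrow> 0 *\<^sub>C geo w"
    using a by (intro bounded_linear.tendsto[OF bounded_linear_scaleC_left] LIMSEQ_power_zero)
  ultimately show "geo w \<in> {x. (\<lambda>n. T (s * real n) x) \<longlonglongrightarrow> 0}" by simp
qed

text \<open>
  The points whose orbit meets a given ball form an open set, which is dense by transitivity. Take
  the intersection of these sets over the balls of radius \<open>1 / (k + 1)\<close> around a countable dense set;
  by Baire's theorem it contains a point, and the orbit of such a point is dense.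
\<close>

lemma birkhoff_transitivity:
  fixes S :: "nat \<Rightarrow> 'a::complete_space \<Rightarrow> 'a" and C :: "'a set"
  assumes C: "countable C" "closure C = UNIV"
    and cont: "\<And>n. continuous_on UNIV (S n)"
    and trans: "\<And>U W. open U \<Longrightarrow> U \<noteq> {} \<Longrightarrow> open W \<Longrightarrow> W \<noteq> {} \<Longrightarrow> \<exists>n. \<exists>x\<in>U. S n x \<in> W"
  shows "\<exists>x. closure (range (\<lambda>n. S n x)) = UNIV"
proof -
  define G where "G = (\<lambda>(c, k). \<Union>n. S n -` ball c (1 / real (Suc k))) ` (C \<times> (UNIV :: nat set))"
  have "euclidean closure_of \<Inter>G = (UNIV :: 'a set)"
  proof (rule Met_TC.metric_Baire_category[unfolded mtopology_is_euclidean])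
    show "Met_TC.mcomplete TYPE('a)" by (simp add: complete_UNIV)
    show "countable G" unfolding G_def using C(1) by auto
    fix V assume "V \<in> G"
    then obtain c k where V: "V = (\<Union>n. S n -` ball c (1 / real (Suc k)))"
      unfolding G_def by auto
    have "open V" unfolding V using cont by (intro open_UN ballI open_vimage open_ball)
    moreover have "\<exists>y\<in>V. dist y x < e" if "e > 0" for x e
    proof -
      have "\<exists>n. \<exists>y\<in>ball x e. S n y \<in> ball c (1 / real (Suc k))"
        by (rule trans) (use that in \<open>simp_all del: of_nat_Suc\<close>)
      then obtain n y where "y \<in> ball x e" "S n y \<in> ball c (1 / real (Suc k))" by blast
      then show ?thesis unfolding V by (auto simp: dist_commute intro!: bexI[of _ y])
    qed
    then have "closure V = UNIV" unfolding set_eq_iff closure_approachable by blast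
    ultimately show "openin euclidean V \<and> euclidean closure_of V = UNIV" by simp
  qed
  then have "\<Inter>G \<noteq> {}" by auto
  then obtain x where x: "\<And>c k. c \<in> C \<Longrightarrow> \<exists>n. dist c (S n x) < 1 / real (Suc k)"
    unfolding G_def by fastforce
  have "a \<in> closure (range (\<lambda>n. S n x))" for a
    unfolding closure_approachable
  proof (intro allI impI)
    fix e :: real assume e: "e > 0"
    obtain c where c: "c \<in> C" "dist c a < e / 2"
      using C(2) closure_approachable[of a C] e by (metis UNIV_I half_gt_zero)
    obtain k where k: "1 / real (Suc k) < e / 2"
      using nat_approx_posE[of "e / 2"] e by auto
    obtain n where "dist c (S n x) < e / 2"
      using x[OF c(1), of k] k by (meson less_trans)
    then have "dist (S n x) a < e"
      using c(2) by (metis dist_commute dist_triangle_half_r)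
    then show "\<exists>y\<in>range (\<lambda>n. S n x). dist y a < e" by blast
  qed
  then show ?thesis by auto
qed

text \<open>
  Finite sequences with entries in a countable dense set of complex numbers are dense.
\<close>

lemma c0_separable: "\<exists>C::c0 set. countable C \<and> closure C = UNIV"
proof -
  obtain D :: "complex set" where D: "countable D" "\<And>X. open X \<Longrightarrow> X \<noteq> {} \<Longrightarrow> \<exists>d\<in>D. d \<in> X"
    using countable_dense_exists[where 'a = complex] by metis
  define \<phi> where "\<phi> xs = (\<Sum>j<length xs. xs ! j *\<^sub>C geo_coeff 0 j)" for xs
  have \<phi>: "Rep_c0 (\<phi> xs) k = (if k < length xs then xs ! k else 0)" for xs k
    by (simp add: \<phi>_def Rep_c0_sum Rep_geo_coeff_at_0 if_distrib if_distribR sum.delta cong: if_cong)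
  have "\<exists>y\<in>\<phi> ` lists D. dist y a < e" if e: "e > 0" for a e
  proof -
    obtain N where N: "\<And>n. n \<ge> N \<Longrightarrow> cmod (Rep_c0 a n) < e / 2"
      using LIMSEQ_D[OF Rep_c0_tendsto[of a], of "e / 2"] e by auto
    have "\<exists>d\<in>D. dist (Rep_c0 a n) d < e / 2" for n
      using D(2)[of "ball (Rep_c0 a n) (e / 2)"] e by auto
    then obtain d where d: "\<And>n. d n \<in> D" "\<And>n. dist (Rep_c0 a n) (d n) < e / 2"
      by metis
    define y where "y = \<phi> (map d [0..<N])"
    have "cmod (Rep_c0 (y - a) n) \<le> e / 2" for n
    proof (cases "n < N")
      case True
      then have "cmod (Rep_c0 (y - a) n) = dist (Rep_c0 a n) (d n)"
        by (simp add: y_def \<phi> dist_norm norm_minus_commute)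
      then show ?thesis using d(2)[of n] by simp
    next
      case False
      then have "cmod (Rep_c0 (y - a) n) = cmod (Rep_c0 a n)"
        by (simp add: y_def \<phi>)
      then show ?thesis using N[of n] False by simp
    qed
    then have "norm (y - a) \<le> e / 2" by (rule norm_c0_leI)
    also have "\<dots> < e" using e by simp
    finally have "dist y a < e" by (simp add: dist_norm)
    moreover have "y \<in> \<phi> ` lists D" 
      unfolding y_def using d(1) by (intro imageI) auto
    ultimately show ?thesis by blast
  qed
  then have "closure (\<phi> ` lists D) = UNIV"
    unfolding set_eq_iff closure_approachable by blast
  moreover have "countable (\<phi> ` lists D)" using D(1) by simp
  ultimately show ?thesis by blast
qed

text \<open>
  For transitivity from \<open>U\<close> to \<open>W\<close>, choose \<open>x \<in> U\<close> whose forward orbit and \<open>y \<in> W\<close> whose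
  backward orbit tend to 0. The points \<open>x + T (- n) y\<close> tend to \<open>x\<close>, and their images
  \<open>T n x + y\<close> under \<open>T n\<close> tend to \<open>y\<close>.
\<close>

lemma dense_orbit:
  assumes \<rho>: "\<rho> > 0" and f: "f holomorphic_on ball 0 \<rho>" "\<not> f constant_on ball 0 \<rho>"
    and T: "\<And>t. has_symbol \<rho> (T t) (\<lambda>z. exp (of_real t * f z))"
    and z: "z \<in> ball 0 \<rho>" "Re (f z) = 0"
  shows "\<exists>x. closure {T t x |t. t \<ge> 0} = UNIV"
proof -
  have "\<exists>n. \<exists>x\<in>U. T (real n) x \<in> W" if U: "open U" "U \<noteq> {}" and W: "open W" "W \<noteq> {}" for U W
  proof -
    obtain x where x: "x \<in> U" "(\<lambda>n. T (1 * real n) x) \<longlonglongrightarrow> 0"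
      using decaying_orbits_dense[OF \<rho> f T z, of 1] U
        open_Int_closure_eq_empty[OF U(1), of "{x. (\<lambda>n. T (1 * real n) x) \<longlonglongrightarrow> 0}"] by auto
    obtain y where y: "y \<in> W" "(\<lambda>n. T (-1 * real n) y) \<longlonglongrightarrow> 0"
      using decaying_orbits_dense[OF \<rho> f T z, of "-1"] W
        open_Int_closure_eq_empty[OF W(1), of "{x. (\<lambda>n. T (-1 * real n) x) \<longlonglongrightarrow> 0}"] by auto
    have "(\<lambda>n. x + T (-1 * real n) y) \<longlonglongrightarrow> x"
      using tendsto_add[OF tendsto_const y(2), of x] by simp
    then have 1: "\<forall>\<^sub>F n in sequentially. x + T (-1 * real n) y \<in> U"
      using U(1) x(1) by (rule topological_tendstoD)
    have "T (real n) (x + T (-1 * real n) y) = T (1 * real n) x + y" for n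
      using exp_symbol_add[OF T, of "real n" "- real n" y] exp_symbol_0[OF T]
      by (simp add: blinfun.add_right)
    moreover have "(\<lambda>n. T (1 * real n) x + y) \<longlonglongrightarrow> y"
      using tendsto_add[OF x(2) tendsto_const, of y] by simp
    ultimately have 2: "\<forall>\<^sub>F n in sequentially. T (real n) (x + T (-1 * real n) y) \<in> W"
      using topological_tendstoD[OF _ W(1) y(1)] by simp
    show ?thesis
      using eventually_happens[OF eventually_conj[OF 1 2]] by auto
  qed
  note trans = this
  obtain C :: "c0 set" where C: "countable C" "closure C = UNIV" using c0_separable by blast
  have "continuous_on UNIV (blinfun_apply (T (real n)))" for n
    by (intro linear_continuous_on blinfun.bounded_linear_right)
  from birkhoff_transitivity[OF C this trans]
  obtain x where x: "closure (range (\<lambda>n. T (real n) x)) = UNIV" by blast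
  have "range (\<lambda>n. T (real n) x) \<subseteq> {T t x |t. t \<ge> 0}" by auto
  then show ?thesis using x closure_mono by blast
qed

section \<open>Chaos on Herzog spaces\<close>

text \<open>
  \<open>herzog_fun \<rho>\<close> is an isometry of \<open>c\<^sub>0\<close> onto \<open>X\<^sub>\<rho>\<close>.
\<close>

lemma herzog_closure_of_image:
  assumes \<rho>: "\<rho> > 0"
  shows "herzog_topology \<rho> closure_of (herzog_fun \<rho> ` S) = herzog_fun \<rho> ` closure S"
proof -
  interpret Metric_space "herzog_space \<rho>" "\<lambda>f g. herzog_norm \<rho> (\<lambda>x. f x - g x)"
    by (rule Metric_space_herzog[OF \<rho>])
  have d: "herzog_norm \<rho> (\<lambda>x. herzog_fun \<rho> a x - herzog_fun \<rho> b x) = dist a b" for a b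
    using herzog_norm_fun[OF \<rho>, of "a - b"] by (simp add: dist_norm herzog_fun_diff[abs_def])
  have in_ball: "herzog_fun \<rho> b \<in> mball (herzog_fun \<rho> a) r \<longleftrightarrow> dist b a < r" for a b r
    unfolding in_mball d using rangeI[of "herzog_fun \<rho>"]
    by (simp add: herzog_space_def[symmetric] dist_commute)
  have "herzog_fun \<rho> a \<in> mtopology closure_of (herzog_fun \<rho> ` S) \<longleftrightarrow> a \<in> closure S" for a
    unfolding metric_closure_of closure_approachable
    using rangeI[of "herzog_fun \<rho>" a] by (simp add: in_ball herzog_space_def[symmetric] del: in_mball)
  moreover have "mtopology closure_of (herzog_fun \<rho> ` S) \<subseteq> range (herzog_fun \<rho>)"
    unfolding metric_closure_of herzog_space_def[symmetric] by blast
  ultimately show ?thesis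
    unfolding herzog_topology_def by blast
qed

lemma topspace_herzog: "\<rho> > 0 \<Longrightarrow> topspace (herzog_topology \<rho>) = range (herzog_fun \<rho>)"
  unfolding herzog_topology_def
  by (simp add: Metric_space.topspace_mtopology[OF Metric_space_herzog] flip: herzog_space_def)

lemma devaney_chaotic_herzog_iff:
  fixes f :: "complex \<Rightarrow> complex"
  assumes \<rho>: "\<rho> > 0"
  defines "T \<equiv> \<lambda>t. op_exp (t *\<^sub>R riesz_dunford f (herzog_deriv \<rho>))"
  shows "devaney_chaotic (herzog_topology \<rho>) (herzog_semigroup \<rho> f) \<longleftrightarrow>
           (\<exists>x. closure {T t x |t. t \<ge> 0} = UNIV) \<and> closure {x. \<exists>t>0. T t x = x} = UNIV"
proof -
  have T: "herzog_semigroup \<rho> f t (herzog_fun \<rho> x) = herzog_fun \<rho> (T t x)" for t x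
    by (simp add: herzog_semigroup_def T_def herzog_coeff_fun[OF \<rho>])
  have onto: "herzog_topology \<rho> closure_of (herzog_fun \<rho> ` S) = range (herzog_fun \<rho>) \<longleftrightarrow>
      closure S = UNIV" for S
    unfolding herzog_closure_of_image[OF \<rho>] by (rule inj_image_eq_iff[OF inj_herzog_fun[OF \<rho>]])
  have orbit: "{herzog_semigroup \<rho> f t (herzog_fun \<rho> x) |t. t \<ge> 0} =
      herzog_fun \<rho> ` {T t x |t. t \<ge> 0}" for x
    unfolding T by blast
  have per: "{u \<in> range (herzog_fun \<rho>). \<exists>t>0. herzog_semigroup \<rho> f t u = u} =
      herzog_fun \<rho> ` {x. \<exists>t>0. T t x = x}"
  proof (intro equalityI subsetI)
    fix u assume "u \<in> {u \<in> range (herzog_fun \<rho>). \<exists>t>0. herzog_semigroup \<rho> f t u = u}"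
    then obtain x t where "u = herzog_fun \<rho> x" "t > 0" "herzog_fun \<rho> (T t x) = herzog_fun \<rho> x"
      by (auto simp: T)
    then show "u \<in> herzog_fun \<rho> ` {x. \<exists>t>0. T t x = x}"
      using injD[OF inj_herzog_fun[OF \<rho>]] by blast
  next
    fix u assume "u \<in> herzog_fun \<rho> ` {x. \<exists>t>0. T t x = x}"
    then obtain x t where "u = herzog_fun \<rho> x" "t > 0" "T t x = x" by blast
    then show "u \<in> {u \<in> range (herzog_fun \<rho>). \<exists>t>0. herzog_semigroup \<rho> f t u = u}"
      using T[of t x] by auto
  qed
  show ?thesis
    unfolding devaney_chaotic_def topspace_herzog[OF \<rho>] per onto
    by (simp add: orbit onto)
qed

theorem herzog_semigroup_chaotic_iff:
  assumes \<rho>: "\<rho> > 0" and f: "f holomorphic_on U" "open U" "cball 0 \<rho> \<subseteq> U"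
    and nc: "\<nexists>c. Re c = 0 \<and> (\<forall>z\<in>ball 0 \<rho>. f z = c)"
  shows "devaney_chaotic (herzog_topology \<rho>) (herzog_semigroup \<rho> f) \<longleftrightarrow>
           (\<exists>z\<in>ball 0 \<rho>. Re (f z) = 0)"
proof -
  obtain R where R: "\<rho> < R" "ball 0 R \<subseteq> U"
    using ex_larger_ball[OF f(2,3) \<rho>] by blast
  define T where "T t = op_exp (t *\<^sub>R riesz_dunford f (herzog_deriv \<rho>))" for t
  have T: "has_symbol \<rho> (T t) (\<lambda>z. exp (of_real t * f z))" for t
    unfolding T_def by (intro has_symbol_op_exp has_symbol_riesz_dunford[OF \<rho> f])
  have fR: "f holomorphic_on ball 0 R"
    using f(1) R(2) by (rule holomorphic_on_subset)
  have f\<rho>: "f holomorphic_on ball 0 \<rho>"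
    using fR R(1) by (intro holomorphic_on_subset[OF fR] subset_ball) simp
  show ?thesis
    unfolding devaney_chaotic_herzog_iff[OF \<rho>] T_def[symmetric]
  proof
    assume "(\<exists>x. closure {T t x |t. t \<ge> 0} = UNIV) \<and> closure {x. \<exists>t>0. T t x = x} = UNIV"
    then show "\<exists>z\<in>ball 0 \<rho>. Re (f z) = 0"
      using periodic_points_dense_imp[OF \<rho> R(1) fR T] by blast
  next
    assume "\<exists>z\<in>ball 0 \<rho>. Re (f z) = 0"
    then obtain z where z: "z \<in> ball 0 \<rho>" "Re (f z) = 0" by blast
    have "\<not> f constant_on ball 0 \<rho>"
      using nc z unfolding constant_on_def by metis
    then show "(\<exists>x. closure {T t x |t. t \<ge> 0} = UNIV) \<and> closure {x. \<exists>t>0. T t x = x} = UNIV"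
      using dense_orbit[OF \<rho> f\<rho> _ T z] periodic_points_dense[OF \<rho> f\<rho> _ T z] by blast
  qed
qed

text \<open>
  If \<open>P / Q\<close> were an imaginary constant \<open>c\<close> on the disc, then \<open>P = c Q\<close> on the whole plane by
  analytic continuation; so the exclusion of the degenerate case may be stated globally.
\<close>

corollary herzog_semigroup_quotient_chaotic_iff:
  assumes \<rho>: "\<rho> > 0" and P: "P holomorphic_on UNIV" and Q: "Q holomorphic_on UNIV"
    and nz: "\<And>z. z \<in> cball 0 \<rho> \<Longrightarrow> Q z \<noteq> 0"
    and nc: "\<nexists>c. Re c = 0 \<and> (\<forall>z. P z = c * Q z)"
  shows "devaney_chaotic (herzog_topology \<rho>) (herzog_semigroup \<rho> (\<lambda>z. P z / Q z)) \<longleftrightarrow>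
           (\<exists>z0\<in>ball 0 \<rho>. \<exists>l0. Re l0 = 0 \<and> P z0 = l0 * Q z0)"
proof -
  define U where "U = - (Q -` {0})"
  have "open U"
    unfolding U_def
    using continuous_closed_vimage[OF closed_singleton, of Q 0] holomorphic_on_imp_continuous_on[OF Q]
    by (simp add: continuous_on_eq_continuous_at open_Compl)
  moreover have "(\<lambda>z. P z / Q z) holomorphic_on U"
    by (intro holomorphic_intros holomorphic_on_subset[OF P] holomorphic_on_subset[OF Q])
      (auto simp: U_def)
  moreover have "cball 0 \<rho> \<subseteq> U" using nz by (auto simp: U_def)
  moreover have "\<nexists>c. Re c = 0 \<and> (\<forall>z\<in>ball 0 \<rho>. P z / Q z = c)"
  proof
    assume "\<exists>c. Re c = 0 \<and> (\<forall>z\<in>ball 0 \<rho>. P z / Q z = c)"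
    then obtain c where c: "Re c = 0" "\<And>z. z \<in> ball 0 \<rho> \<Longrightarrow> P z / Q z = c" by blast
    have eq: "P z = c * Q z" if "z \<in> ball 0 \<rho>" for z
      using c(2)[OF that] nz[of z] that by (auto simp: field_simps)
    have "P z = c * Q z" for z
    proof (rule analytic_continuation_open[of "ball 0 \<rho>" UNIV P "\<lambda>z. c * Q z"])
      show "(\<lambda>z. c * Q z) holomorphic_on UNIV" by (intro holomorphic_intros Q)
    qed (use \<rho> P eq in auto)
    then show False using nc c(1) by blast
  qed
  ultimately have "devaney_chaotic (herzog_topology \<rho>) (herzog_semigroup \<rho> (\<lambda>z. P z / Q z)) \<longleftrightarrow>
      (\<exists>z\<in>ball 0 \<rho>. Re (P z / Q z) = 0)"
    by (intro herzog_semigroup_chaotic_iff[OF \<rho>]) auto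
  also have "\<dots> \<longleftrightarrow> (\<exists>z0\<in>ball 0 \<rho>. \<exists>l0. Re l0 = 0 \<and> P z0 = l0 * Q z0)"
  proof (intro bex_cong refl)
    fix z :: complex assume "z \<in> ball 0 \<rho>"
    then have "Q z \<noteq> 0" using nz[of z] by auto
    then show "Re (P z / Q z) = 0 \<longleftrightarrow> (\<exists>l0. Re l0 = 0 \<and> P z = l0 * Q z)"
      by (metis nonzero_mult_div_cancel_right nonzero_divide_eq_eq)
  qed
  finally show ?thesis .
qed

lemma holomorphic_pde_p: "pde_p m a0 holomorphic_on S"
  unfolding pde_p_def[abs_def] by (intro holomorphic_intros)

lemma holomorphic_pde_q: "pde_q m a1 holomorphic_on S"
  unfolding pde_q_def[abs_def] by (intro holomorphic_intros)

text \<open>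
  \<open>\<bar>\<alpha>\<bar> \<rho>\<^sup>k < 1\<close>, so the denominator of the second symbol has no zero in the closed disc.
\<close>

lemma one_minus_power_nonzero:
  assumes k: "k \<ge> 1" and \<rho>: "\<rho> > 0" "\<alpha> = 0 \<or> \<rho> < 1 / root k (cmod \<alpha>)" and z: "cmod z \<le> \<rho>"
  shows "1 - \<alpha> * z ^ k \<noteq> 0"
proof (cases "\<alpha> = 0")
  case False
  define s where "s = root k (cmod \<alpha>)"
  have s: "s > 0" "s ^ k = cmod \<alpha>"
    using False k by (auto simp: s_def)
  have "s * cmod z \<le> s * \<rho>" using z s(1) by simp
  also have "\<dots> < 1" using \<rho>(2) False s(1) by (simp add: s_def[symmetric] field_simps)
  finally have "(s * cmod z) ^ k < 1"
    using power_strict_mono[of "s * cmod z" 1 k] s(1) k by simp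
  then have "cmod (\<alpha> * z ^ k) < 1" by (simp add: norm_mult norm_power power_mult_distrib s(2))
  then show ?thesis by auto
qed simp

theorem corollary3p7:
  fixes m :: nat and a0 a1 :: "nat \<Rightarrow> complex"
  shows
    "((\<nexists>c. Re c = 0 \<and> (\<forall>z. pde_p m a0 z = c * pde_q m a1 z)) \<longrightarrow>
     (\<forall>\<rho>>0. {z. pde_q m a1 z = 0} \<subseteq> UNIV - cball 0 \<rho> \<longrightarrow>
       (devaney_chaotic (herzog_topology \<rho>)
          (herzog_semigroup \<rho> (\<lambda>z. pde_p m a0 z / pde_q m a1 z))
        \<longleftrightarrow> (\<exists>z0\<in>ball 0 \<rho>. \<exists>l0. Re l0 = 0 \<and> pde_p m a0 z0 = l0 * pde_q m a1 z0))))
     \<and>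
     (\<forall>(\<alpha>::complex) (k::nat). k \<ge> 1 \<longrightarrow>
     (\<nexists>c. Re c = 0 \<and> (\<forall>z. pde_p m a0 z = c * (1 - \<alpha> * z ^ k))) \<longrightarrow>
     (\<forall>\<rho>>0. \<alpha> = 0 \<or> \<rho> < 1 / root k (cmod \<alpha>) \<longrightarrow>
       (devaney_chaotic (herzog_topology \<rho>)
          (herzog_semigroup \<rho> (\<lambda>z. pde_p m a0 z / (1 - \<alpha> * z ^ k)))
        \<longleftrightarrow> (\<exists>z0\<in>ball 0 \<rho>. \<exists>l0. Re l0 = 0 \<and> pde_p m a0 z0 = l0 * (1 - \<alpha> * z0 ^ k)))))"
proof (intro conjI impI allI)
  fix \<rho> :: real
  assume "\<nexists>c. Re c = 0 \<and> (\<forall>z. pde_p m a0 z = c * pde_q m a1 z)" "0 < \<rho>"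
    and "{z. pde_q m a1 z = 0} \<subseteq> UNIV - cball 0 \<rho>"
  then show "devaney_chaotic (herzog_topology \<rho>)
          (herzog_semigroup \<rho> (\<lambda>z. pde_p m a0 z / pde_q m a1 z))
        \<longleftrightarrow> (\<exists>z0\<in>ball 0 \<rho>. \<exists>l0. Re l0 = 0 \<and> pde_p m a0 z0 = l0 * pde_q m a1 z0)"
    by (intro herzog_semigroup_quotient_chaotic_iff holomorphic_pde_p holomorphic_pde_q) blast+
next
  fix \<alpha> :: complex and k :: nat and \<rho> :: real
  assume k: "k \<ge> 1" and nc: "\<nexists>c. Re c = 0 \<and> (\<forall>z. pde_p m a0 z = c * (1 - \<alpha> * z ^ k))"
    and \<rho>: "0 < \<rho>" "\<alpha> = 0 \<or> \<rho> < 1 / root k (cmod \<alpha>)"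
  show "devaney_chaotic (herzog_topology \<rho>)
          (herzog_semigroup \<rho> (\<lambda>z. pde_p m a0 z / (1 - \<alpha> * z ^ k)))
        \<longleftrightarrow> (\<exists>z0\<in>ball 0 \<rho>. \<exists>l0. Re l0 = 0 \<and> pde_p m a0 z0 = l0 * (1 - \<alpha> * z0 ^ k))"
  proof (rule herzog_semigroup_quotient_chaotic_iff[OF \<rho>(1) holomorphic_pde_p _ _ nc])
    show "(\<lambda>z. 1 - \<alpha> * z ^ k) holomorphic_on UNIV" by (intro holomorphic_intros)
    show "1 - \<alpha> * z ^ k \<noteq> 0" if "z \<in> cball 0 \<rho>" for z
      using one_minus_power_nonzero[OF k \<rho>, of z] that by simp
  qed
qed

end
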